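(* The following decision problem $\textsf{Loc}_{G,1}$ is in $\mathsf{P}$: given a finite, connected, undirected graph $G=(V,E)$ and a valid colouring $c:V\to[\ell]$ (for some $\ell\in\mathbb{N}$), decide whether $\operatorname{loc}(G,c)=1$.
   Context: Graphs are finite, simple and undirected. A colouring of $G=(V,E)$ is a function $c:V\to[\ell]=\{1,\dots,\ell\}$; it is valid if $\{u,v\}\in E$ implies $c(u)\ne c(v)$. Let $\mathcal C(G,c)=\{c(v)\mid v\in V\}$ and $m=|\mathcal C(G,c)|$. A marking sequence is an enumeration $e=(x_1,\dots,x_m)$ of $\mathcal C(G,c)$. For $i\in[m]$ let $G_i$ be the subgraph of $G$ induced by $\{v\in V\mid c(v)\in\{x_1,\dots,x_i\}\}$. Let $\gamma(H)$ denote the number of connected components of $H$. Define $\operatorname{loc}(G,c,e)=\max_{i\in[m]}\gamma(G_i)$ and $\operatorname{loc}(G,c)=\min_e\operatorname{loc}(G,c,e)$ over all marking sequences $e$. *)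

theory Defs
  imports Main "HOL-Computational_Algebra.Polynomial"
begin

definition simple_graph :: "'v set \<Rightarrow> 'v set set \<Rightarrow> bool" where
  "simple_graph V E \<longleftrightarrow> finite V \<and> (\<forall>e\<in>E. \<exists>u\<in>V. \<exists>v\<in>V. u \<noteq> v \<and> e = {u, v})"

definition path_rel :: "'v set \<Rightarrow> 'v set set \<Rightarrow> ('v \<times> 'v) set" where
  "path_rel V E = {(u, v). u \<in> V \<and> v \<in> V \<and> (u, v) \<in> {(a, b). {a, b} \<in> E}\<^sup>*}"

definition connected_graph :: "'v set \<Rightarrow> 'v set set \<Rightarrow> bool" where
  "connected_graph V E \<longleftrightarrow> V \<noteq> {} \<and> (\<forall>u\<in>V. \<forall>v\<in>V. (u, v) \<in> path_rel V E)"

definition num_components :: "'v set \<Rightarrow> 'v set set \<Rightarrow> nat" where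
  "num_components V E = card (V // path_rel V E)"

definition induced_edges :: "'v set set \<Rightarrow> 'v set \<Rightarrow> 'v set set" where
  "induced_edges E W = {e \<in> E. e \<subseteq> W}"

definition valid_colouring :: "'v set \<Rightarrow> 'v set set \<Rightarrow> ('v \<Rightarrow> nat) \<Rightarrow> nat \<Rightarrow> bool" where
  "valid_colouring V E c l \<longleftrightarrow>
     (\<forall>v\<in>V. c v \<in> {1..l}) \<and> (\<forall>u\<in>V. \<forall>v\<in>V. {u, v} \<in> E \<longrightarrow> c u \<noteq> c v)"

definition marking_seqs :: "'v set \<Rightarrow> ('v \<Rightarrow> nat) \<Rightarrow> nat list set" where
  "marking_seqs V c = {xs. distinct xs \<and> set xs = c ` V}"

definition marked_vertices :: "'v set \<Rightarrow> ('v \<Rightarrow> nat) \<Rightarrow> nat list \<Rightarrow> nat \<Rightarrow> 'v set" where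
  "marked_vertices V c xs i = {v \<in> V. c v \<in> set (take i xs)}"

text \<open>The maximum below is over an empty set, hence unspecified, if \<open>V\<close> is empty; connected
  graphs are non-empty by definition.\<close>

definition loc_seq :: "'v set \<Rightarrow> 'v set set \<Rightarrow> ('v \<Rightarrow> nat) \<Rightarrow> nat list \<Rightarrow> nat" where
  "loc_seq V E c xs = Max ((\<lambda>i. num_components (marked_vertices V c xs i)
     (induced_edges E (marked_vertices V c xs i))) ` {1..length xs})"

definition loc :: "'v set \<Rightarrow> 'v set set \<Rightarrow> ('v \<Rightarrow> nat) \<Rightarrow> nat" where
  "loc V E c = Min (loc_seq V E c ` marking_seqs V c)"

text \<open>A tape cell contains a blank, a letter of the input alphabet \<open>'a\<close>, or one of finitely many
  auxiliary symbols (\<open>tm_symbols\<close> is required to be finite below).\<close>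

datatype 'a cell = Blank | Inp 'a | Aux nat

datatype direction = Move_Left | Stay | Move_Right

record 'a tm =
  tm_tapes :: nat
  tm_states :: "nat set"
  tm_symbols :: "'a cell set"
  tm_start :: nat
  tm_accept :: nat
  tm_reject :: nat
  tm_trans :: "nat \<Rightarrow> 'a cell list \<Rightarrow> nat \<times> ('a cell \<times> direction) list"

definition wf_tm :: "'a tm \<Rightarrow> bool" where
  "wf_tm M \<longleftrightarrow>
     tm_tapes M \<ge> 1 \<and> finite (tm_states M) \<and> finite (tm_symbols M) \<and>
     Blank \<in> tm_symbols M \<and> range Inp \<subseteq> tm_symbols M \<and>
     {tm_start M, tm_accept M, tm_reject M} \<subseteq> tm_states M \<and> tm_accept M \<noteq> tm_reject M \<and>
     (\<forall>q \<in> tm_states M - {tm_accept M, tm_reject M}. \<forall>ys.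
        length ys = tm_tapes M \<and> set ys \<subseteq> tm_symbols M \<longrightarrow>
        (let (q', as) = tm_trans M q ys
         in q' \<in> tm_states M \<and> length as = tm_tapes M \<and> fst ` set as \<subseteq> tm_symbols M))"

text \<open>Tapes are infinite in both directions; a tape is given by its contents and the position of
  its head.\<close>

type_synonym 'a tape = "(int \<Rightarrow> 'a cell) \<times> int"
type_synonym 'a config = "nat \<times> 'a tape list"

definition read_tape :: "'a tape \<Rightarrow> 'a cell" where
  "read_tape t = fst t (snd t)"

fun move_head :: "direction \<Rightarrow> int \<Rightarrow> int" where
  "move_head Move_Left h = h - 1"
| "move_head Stay h = h"
| "move_head Move_Right h = h + 1"

fun act_tape :: "'a cell \<times> direction \<Rightarrow> 'a tape \<Rightarrow> 'a tape" where
  "act_tape (y, d) (f, h) = (f(h := y), move_head d h)"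

fun tm_step :: "'a tm \<Rightarrow> 'a config \<Rightarrow> 'a config" where
  "tm_step M (q, ts) =
     (if q = tm_accept M \<or> q = tm_reject M then (q, ts)
      else let (q', as) = tm_trans M q (map read_tape ts) in (q', map2 act_tape as ts))"

definition input_tape :: "'a list \<Rightarrow> 'a tape" where
  "input_tape w = (\<lambda>i. if 0 \<le> i \<and> i < int (length w) then Inp (w ! nat i) else Blank, 0)"

definition tm_init :: "'a tm \<Rightarrow> 'a list \<Rightarrow> 'a config" where
  "tm_init M w = (tm_start M, input_tape w # replicate (tm_tapes M - 1) (\<lambda>_. Blank, 0))"

text \<open>The accepting and rejecting states are halting, so being in one of them after \<open>t\<close> steps
  means having halted within \<open>t\<close> steps.\<close>

definition decides_in_time :: "'a tm \<Rightarrow> 'a list set \<Rightarrow> (nat \<Rightarrow> nat) \<Rightarrow> bool" where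
  "decides_in_time M A T \<longleftrightarrow>
     (\<forall>w. \<exists>t \<le> T (length w).
        fst ((tm_step M ^^ t) (tm_init M w)) = (if w \<in> A then tm_accept M else tm_reject M))"

definition class_P :: "'a::finite list set set" where
  "class_P = {A. \<exists>M (p :: nat poly). wf_tm M \<and> decides_in_time M A (poly p)}"

datatype letter = Zero | One | Sep

instance letter :: finite
proof
  have "(UNIV :: letter set) \<subseteq> {Zero, One, Sep}"
    using letter.exhaust by blast
  then show "finite (UNIV :: letter set)"
    by (rule finite_subset) simp
qed

text \<open>Binary notation, most significant digit first and without leading zeros.\<close>

fun binary :: "nat \<Rightarrow> letter list" where
  "binary n = (if n = 0 then [] else binary (n div 2) @ [if odd n then One else Zero])"

declare binary.simps [simp del]

text \<open>A coloured graph is encoded with respect to an enumeration \<open>vs\<close> of its vertices: for each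
  vertex in turn, its row of the adjacency matrix, a separator, its colour in binary, and a
  separator. The names of the vertices do not occur in the encoding.\<close>

definition encode_vertex :: "'v list \<Rightarrow> 'v set set \<Rightarrow> ('v \<Rightarrow> nat) \<Rightarrow> 'v \<Rightarrow> letter list" where
  "encode_vertex vs E c v =
     map (\<lambda>u. if {v, u} \<in> E then One else Zero) vs @ [Sep] @ binary (c v) @ [Sep]"

definition encode :: "'v list \<Rightarrow> 'v set set \<Rightarrow> ('v \<Rightarrow> nat) \<Rightarrow> letter list" where
  "encode vs E c = concat (map (encode_vertex vs E c) vs)"

definition Loc_G_1 :: "letter list set" where
  "Loc_G_1 = {encode vs E c | (vs :: nat list) E c.
     distinct vs \<and> simple_graph (set vs) E \<and> connected_graph (set vs) E \<and>
     (\<exists>l. valid_colouring (set vs) E c l) \<and> loc (set vs) E c = 1}"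

end

theory Submission
  imports Defs "HOL-Library.Nat_Bijection"
begin

text \<open>The colour class marked first is an independent set, so a marking sequence with connected
  stages starts with a colour that occurs only once. Later, a new colour \<open>x\<close> can be added to a
  connected marked set iff every vertex of colour \<open>x\<close> has a marked neighbour. This condition is
  monotone in the marked set, so greedy marking never gets stuck unnecessarily: \<open>loc = 1\<close> iff, for
  some uniquely coloured start vertex \<open>v\<close>, the least set closed under the marking rule and
  containing \<open>v\<close> is all of \<open>V\<close>.

  The machine evaluates first-order formulas over the positions of the input. Well-formedness of
  the input and the marking rule are such formulas, and the least closed set is reached after as many
  passes over the positions as there are positions. Variables of the formulas are marks on the
  second tape, so every quantifier is a loop that moves a mark, and the running time is
  polynomial by induction on the formula. The states of the machine are the continuations of a
  structured program, of which only finitely many occur.\<close>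

section \<open>Structured programs for two-tape machines\<close>

text \<open>The language fixes only an encoding, so the machine must also reject, in polynomial
  time, every word that encodes nothing; and the machine model offers only a transition table.
  Restricting the machine to formulas confines all reasoning about tapes to a few loops, after which
  \<open>accepted\<close> is a combinatorial predicate on words. A position of the word stands both
  for a vertex and for an offset in a field: vertex \<open>u\<close> owns field
  \<open>2 * u\<close>, its adjacency row, and field \<open>2 * u + 1\<close>, its colour. An
  encoding is longer than its number of vertices, so positions suffice, and marks on the tape can
  serve as counters. Colours may be exponential in the length of the input; they are never evaluated
  but compared letter by letter, which is sound because \<open>binary\<close> is injective.\<close>

datatype prog =
    Act bool "letter cell \<Rightarrow> letter cell \<times> direction \<times> bool"
  | Cond prog prog prog
  | Loop prog prog

type_synonym tapes = "letter tape \<times> letter tape"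

fun read_at :: "bool \<Rightarrow> tapes \<Rightarrow> letter cell" where
  "read_at e (s, t) = read_tape (if e then t else s)"

fun act_at :: "bool \<Rightarrow> letter cell \<times> direction \<Rightarrow> tapes \<Rightarrow> tapes" where
  "act_at e a (s, t) = (if e then (s, act_tape a t) else (act_tape a s, t))"

text \<open>\<open>Loop g c\<close> is a search with two exits. The guard tests the current
  candidate and ends the search on success; the body moves to the next candidate and returns
  \<open>False\<close> when none is left. Only \<open>Act\<close> costs time; the other rules just
  add up.\<close>

inductive runs :: "prog \<Rightarrow> tapes \<Rightarrow> bool \<Rightarrow> tapes \<Rightarrow> nat \<Rightarrow> bool" where
  runs_Act: "g (read_at e s) = (y, d, b) \<Longrightarrow> runs (Act e g) s b (act_at e (y, d) s) 1"
| runs_Cond: "runs p s b s' t \<Longrightarrow> runs (if b then q else r) s' b' s'' t' \<Longrightarrow>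
    runs (Cond p q r) s b' s'' (t + t')"
| runs_found: "runs g s True s' t \<Longrightarrow> runs (Loop g c) s True s' t"
| runs_exhausted: "runs g s False s' t \<Longrightarrow> runs c s' False s'' t' \<Longrightarrow>
    runs (Loop g c) s False s'' (t + t')"
| runs_again: "runs g s False s' t \<Longrightarrow> runs c s' True s'' t' \<Longrightarrow> runs (Loop g c) s'' b z t'' \<Longrightarrow>
    runs (Loop g c) s b z (t + t' + t'')"

section \<open>Control states as continuations and their finiteness\<close>

datatype frame = Cond_Frame prog prog | Guard_Frame prog prog | Body_Frame prog prog

datatype control = Halt bool
  | At bool "letter cell \<Rightarrow> letter cell \<times> direction \<times> bool" "frame list"

primrec enter :: "prog \<Rightarrow> frame list \<Rightarrow> control" where
  "enter (Act e g) K = At e g K"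
| "enter (Cond p q r) K = enter p (Cond_Frame q r # K)"
| "enter (Loop g c) K = enter g (Guard_Frame g c # K)"

text \<open>A transfer of control takes no machine step: unwinding goes on until the next action, so
  one control step is one \<open>Act\<close>, as in the time count of \<open>runs\<close>. It
  terminates because every recursive call drops a frame, and going round a loop passes through
  \<open>enter\<close>, which stops at an action.\<close>

fun return :: "bool \<Rightarrow> frame list \<Rightarrow> control" where
  "return b [] = Halt b"
| "return b (Cond_Frame q r # K) = enter (if b then q else r) K"
| "return b (Guard_Frame g c # K) = (if b then return True K else enter c (Body_Frame g c # K))"
| "return b (Body_Frame g c # K) = (if b then enter g (Guard_Frame g c # K) else return False K)"

fun control_step :: "control \<times> tapes \<Rightarrow> control \<times> tapes" where
  "control_step (Halt b, s) = (Halt b, s)"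
| "control_step (At e g K, s) =
    (let (y, d, b) = g (read_at e s) in (return b K, act_at e (y, d) s))"

lemma runs_control_step:
  "runs p s b s' t \<Longrightarrow> (control_step ^^ t) (enter p K, s) = (return b K, s')"
proof (induction arbitrary: K rule: runs.induct)
  case (runs_Cond p s b s' t q r b' s'' t')
  \<comment> \<open>\<open>funpow_add\<close> makes the right summand the inner iterate, so the run
    of \<open>p\<close> has to stand on the right.\<close>
  have "t + t' = t' + t" by simp
  with runs_Cond show ?case
    by (simp only: funpow_add comp_apply enter.simps return.simps)
next
  case (runs_exhausted g s s' t c s'' t')
  have "t + t' = t' + t" by simp
  with runs_exhausted show ?case
    by (simp only: funpow_add comp_apply enter.simps return.simps if_True if_False simp_thms)
next
  case (runs_again g s s' t c s'' t' b z t'')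
  have "t + t' + t'' = t'' + (t' + t)" by simp
  with runs_again show ?case
    by (simp only: funpow_add comp_apply enter.simps return.simps if_True if_False simp_thms)
qed auto

text \<open>A repetition of a loop does not lengthen the stack, since guard and body frames replace
  one another. The stack depth is therefore bounded by the nesting of the program, and finitely many
  control states cover every run.\<close>

primrec points :: "prog \<Rightarrow> frame list \<Rightarrow> control set" where
  "points (Act e g) K = {At e g K}"
| "points (Cond p q r) K = points p (Cond_Frame q r # K) \<union> points q K \<union> points r K"
| "points (Loop g c) K = points g (Guard_Frame g c # K) \<union> points c (Body_Frame g c # K)"

lemma finite_points: "finite (points p K)"
  by (induction p arbitrary: K) auto

lemma enter_in_points: "enter p K \<in> points p K"
  by (induction p arbitrary: K) auto

text \<open>Invariance of the state set: a result is either consumed inside \<open>p\<close> or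
  leaves \<open>p\<close>, with some result, for the stack below. With an empty stack the latter
  means halting.\<close>

lemma return_in_points:
  "At e g K' \<in> points p K \<Longrightarrow> return b K' \<in> points p K \<union> range (\<lambda>b'. return b' K)"
proof (induction p arbitrary: K)
  case (Cond p q r)
  have "range (\<lambda>b'. return b' (Cond_Frame q r # K)) \<subseteq> points q K \<union> points r K"
    using enter_in_points[of q K] enter_in_points[of r K] by (simp add: image_subset_iff)
  then show ?case
    using Cond.IH(1)[of "Cond_Frame q r # K"] Cond.IH(2,3)[of K] Cond.prems
    unfolding points.simps by blast
next
  case (Loop g c)
  have "range (\<lambda>b'. return b' (Guard_Frame g c # K)) \<subseteq>
      points c (Body_Frame g c # K) \<union> range (\<lambda>b'. return b' K)"
    using enter_in_points[of c "Body_Frame g c # K"] by (simp add: image_subset_iff)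
  moreover have "range (\<lambda>b'. return b' (Body_Frame g c # K)) \<subseteq>
      points g (Guard_Frame g c # K) \<union> range (\<lambda>b'. return b' K)"
    using enter_in_points[of g "Guard_Frame g c # K"] by (simp add: image_subset_iff)
  ultimately show ?case
    using Loop.IH(1)[of "Guard_Frame g c # K"] Loop.IH(2)[of "Body_Frame g c # K"] Loop.prems
    unfolding points.simps by blast
qed auto

primrec writes_in :: "letter cell set \<Rightarrow> prog \<Rightarrow> bool" where
  "writes_in C (Act e g) = (\<forall>y\<in>C. fst (g y) \<in> C)"
| "writes_in C (Cond p q r) = (writes_in C p \<and> writes_in C q \<and> writes_in C r)"
| "writes_in C (Loop g c) = (writes_in C g \<and> writes_in C c)"

lemma points_writes_in:
  "writes_in C p \<Longrightarrow> At e g K' \<in> points p K \<Longrightarrow> y \<in> C \<Longrightarrow> fst (g y) \<in> C"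
  by (induction p arbitrary: K) auto

section \<open>Turing machines from structured programs\<close>

definition control_trans ::
  "(control \<Rightarrow> nat) \<Rightarrow> control set \<Rightarrow> nat \<Rightarrow> letter cell list \<Rightarrow> nat \<times> (letter cell \<times> direction) list"
  where
  "control_trans f Q q ys = (case the_inv_into Q f q of
      Halt b \<Rightarrow> (q, map (\<lambda>y. (y, Stay)) ys)
    | At e g K \<Rightarrow> (let (y, d, b) = g (ys ! (if e then 1 else 0)) in
        (f (return b K), if e then [(ys ! 0, Stay), (y, d)] else [(y, d), (ys ! 1, Stay)])))"

definition prog_tm :: "(control \<Rightarrow> nat) \<Rightarrow> control set \<Rightarrow> letter cell set \<Rightarrow> prog \<Rightarrow> letter tm" where
  "prog_tm f Q C p = \<lparr>tm_tapes = 2, tm_states = f ` Q, tm_symbols = C, tm_start = f (enter p []),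
     tm_accept = f (Halt True), tm_reject = f (Halt False), tm_trans = control_trans f Q\<rparr>"

text \<open>Both halting controls are included even if one of them is never reached, since a machine
  must have two distinct halting states.\<close>

definition prog_states :: "prog \<Rightarrow> control set" where
  "prog_states p = points p [] \<union> range Halt"

lemma finite_prog_states: "finite (prog_states p)"
  by (simp add: prog_states_def finite_points)

lemma return_in_prog_states: "At e g K \<in> prog_states p \<Longrightarrow> return b K \<in> prog_states p"
  using return_in_points[of e g K p "[]" b] by (auto simp: prog_states_def)

lemma act_tape_Stay: "act_tape (read_tape t, Stay) t = t"
  by (cases t) (simp add: read_tape_def)

lemma prog_tm_step:
  assumes "inj_on f (prog_states p)" and "k \<in> prog_states p"
    and "control_step (k, (s, t)) = (k', (s', t'))"
  shows "tm_step (prog_tm f (prog_states p) C p) (f k, [s, t]) = (f k', [s', t'])"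
    and "k' \<in> prog_states p"
proof -
  have inv: "the_inv_into (prog_states p) f (f k) = k"
    using assms by (simp add: the_inv_into_f_f)
  \<comment> \<open>\<open>tm_step\<close> recognises halting by comparing state numbers;
    injectivity turns this into a test for the constructor \<open>Halt\<close>.\<close>
  have halt: "f k = f (Halt b) \<longleftrightarrow> k = Halt b" for b
    using inj_on_eq_iff[OF assms(1,2), of "Halt b"] by (simp add: prog_states_def)
  show "k' \<in> prog_states p"
  proof (cases k)
    case (At e g K)
    then show ?thesis
      using assms(2,3) return_in_prog_states[of e g K p]
      by (cases "g (read_at e (s, t))") auto
  qed (use assms(2,3) in auto)
  show "tm_step (prog_tm f (prog_states p) C p) (f k, [s, t]) = (f k', [s', t'])"
  proof (cases k)
    case (Halt b)
    then show ?thesis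
      using assms by (cases b) (simp_all add: prog_tm_def)
  next
    case (At e g K)
    then show ?thesis
      using assms(3) inv halt
      by (cases "g (read_at e (s, t))", cases e)
        (simp_all add: prog_tm_def control_trans_def act_tape_Stay)
  qed
qed

lemma prog_tm_steps:
  assumes "inj_on f (prog_states p)" and "k \<in> prog_states p"
    and "(control_step ^^ n) (k, (s, t)) = (k', (s', t'))"
  shows "(tm_step (prog_tm f (prog_states p) C p) ^^ n) (f k, [s, t]) = (f k', [s', t'])"
  using assms(2,3)
proof (induction n arbitrary: k s t)
  case (Suc n)
  obtain k1 s1 t1 where step: "control_step (k, (s, t)) = (k1, (s1, t1))"
    by (metis surj_pair)
  show ?case
    using Suc.IH[of k1 s1 t1] Suc.prems prog_tm_step[OF assms(1) Suc.prems(1) step] step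
    by (simp only: funpow_Suc_right comp_apply)
qed simp

text \<open>The interface to the machine model: transition tables and state numbers disappear behind
  it, leaving a program, a finite alphabet closed under its writing, and a polynomial bound on the
  number of its actions.\<close>

lemma class_P_I:
  assumes C: "finite C" "Blank \<in> C" "range Inp \<subseteq> C" and p: "writes_in C p"
    and runs: "\<And>w. \<exists>t \<le> poly T (length w). \<exists>s.
      runs p (input_tape w, (\<lambda>_. Blank, 0)) (w \<in> A) s t"
  shows "A \<in> class_P"
proof -
  obtain f :: "control \<Rightarrow> nat" where f: "inj_on f (prog_states p)"
    using finite_imp_inj_to_nat_seg[OF finite_prog_states] by blast
  define M where "M = prog_tm f (prog_states p) C p"
  have halt: "Halt b \<in> prog_states p" for b
    by (simp add: prog_states_def)
  have start: "enter p [] \<in> prog_states p"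
    using enter_in_points[of p "[]"] by (simp add: prog_states_def)
  have trans: "let (q', as) = control_trans f (prog_states p) (f k) ys
      in q' \<in> f ` prog_states p \<and> length as = 2 \<and> fst ` set as \<subseteq> C"
    if k: "k \<in> prog_states p" and ys: "length ys = 2" "set ys \<subseteq> C" for k ys
  proof -
    obtain y z where yz: "ys = [y, z]" "y \<in> C" "z \<in> C"
      using ys by (auto simp: numeral_2_eq_2 length_Suc_conv)
    have inv: "the_inv_into (prog_states p) f (f k) = k"
      using f k by (simp add: the_inv_into_f_f)
    show ?thesis
    proof (cases k)
      case (Halt b)
      then show ?thesis
        using k inv yz by (simp add: control_trans_def)
    next
      case (At e g K)
      then have g: "fst (g y) \<in> C" "fst (g z) \<in> C"
        using points_writes_in[OF p] k yz by (auto simp: prog_states_def)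
      then show ?thesis
        using k inv yz At return_in_prog_states[of e g K p]
        by (cases "g y", cases "g z", cases e) (simp_all add: control_trans_def)
    qed
  qed
  have "f (Halt True) \<noteq> f (Halt False)"
    using inj_onD[OF f _ halt halt, of True False] by auto
  moreover have "\<forall>q \<in> f ` prog_states p - {f (Halt True), f (Halt False)}. \<forall>ys.
      length ys = 2 \<and> set ys \<subseteq> C \<longrightarrow> (let (q', as) = control_trans f (prog_states p) q ys
      in q' \<in> f ` prog_states p \<and> length as = 2 \<and> fst ` set as \<subseteq> C)"
  proof (intro ballI allI impI)
    fix q ys
    assume "q \<in> f ` prog_states p - {f (Halt True), f (Halt False)}"
      and ys: "length ys = 2 \<and> set ys \<subseteq> C"
    then obtain k where "k \<in> prog_states p" "q = f k"
      by blast
    then show "let (q', as) = control_trans f (prog_states p) q ys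
      in q' \<in> f ` prog_states p \<and> length as = 2 \<and> fst ` set as \<subseteq> C"
      using trans[of k ys] ys by simp
  qed
  ultimately have "wf_tm M"
    using C halt start finite_prog_states[of p]
    unfolding M_def wf_tm_def prog_tm_def tm.simps by (intro conjI) auto
  moreover have "decides_in_time M A (poly T)"
    unfolding decides_in_time_def
  proof
    fix w
    obtain t s where t: "t \<le> poly T (length w)"
      and r: "runs p (input_tape w, (\<lambda>_. Blank, 0)) (w \<in> A) s t"
      using runs by blast
    obtain s1 s2 where s: "s = (s1, s2)" by (cases s)
    have "tm_init M w = (f (enter p []), [input_tape w, (\<lambda>_. Blank, 0)])"
      by (simp add: tm_init_def M_def prog_tm_def numeral_2_eq_2)
    then have "(tm_step M ^^ t) (tm_init M w) = (f (Halt (w \<in> A)), [s1, s2])"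
      using prog_tm_steps[OF f start runs_control_step[OF r, of "[]", unfolded s, simplified]]
      by (simp add: M_def)
    then show "\<exists>t\<le>poly T (length w). fst ((tm_step M ^^ t) (tm_init M w)) =
        (if w \<in> A then tm_accept M else tm_reject M)"
      using t by (intro exI[of _ t]) (simp add: M_def prog_tm_def)
  qed
  ultimately show ?thesis
    unfolding class_P_def mem_Collect_eq by (intro exI conjI)
qed

section \<open>Programs moving marks on the second tape\<close>

definition runs_within :: "prog \<Rightarrow> tapes \<Rightarrow> bool \<Rightarrow> tapes \<Rightarrow> nat \<Rightarrow> bool" where
  "runs_within p s b s' T \<longleftrightarrow> (\<exists>t\<le>T. runs p s b s' t)"

lemma runs_within_mono: "runs_within p s b s' T \<Longrightarrow> T \<le> T' \<Longrightarrow> runs_within p s b s' T'"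
  unfolding runs_within_def using order_trans by blast

lemma runs_within_Act:
  "g (read_at e s) = (y, d, b) \<Longrightarrow> s' = act_at e (y, d) s \<Longrightarrow> runs_within (Act e g) s b s' 1"
  unfolding runs_within_def using runs_Act by blast

lemma runs_within_Cond:
  assumes "runs_within p s b s' T" and "runs_within (if b then q else r) s' b' s'' T'"
  shows "runs_within (Cond p q r) s b' s'' (T + T')"
proof -
  obtain t t' where "t \<le> T" "t' \<le> T'" "runs p s b s' t" "runs (if b then q else r) s' b' s'' t'"
    using assms unfolding runs_within_def by blast
  then show ?thesis
    unfolding runs_within_def using runs_Cond by (intro exI[of _ "t + t'"]) auto
qed

lemma runs_within_Loop_found:
  "runs_within g s True s' T \<Longrightarrow> runs_within (Loop g c) s True s' T"
  unfolding runs_within_def using runs_found by blast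

lemma runs_within_Loop_exhausted:
  assumes "runs_within g s False s' T" and "runs_within c s' False s'' T'"
  shows "runs_within (Loop g c) s False s'' (T + T')"
proof -
  obtain t t' where "t \<le> T" "t' \<le> T'" "runs g s False s' t" "runs c s' False s'' t'"
    using assms unfolding runs_within_def by blast
  then show ?thesis
    unfolding runs_within_def using runs_exhausted by (intro exI[of _ "t + t'"]) auto
qed

lemma runs_within_Loop_again:
  assumes "runs_within g s False s' T" and "runs_within c s' True s'' T'"
    and "runs_within (Loop g c) s'' b z T''"
  shows "runs_within (Loop g c) s b z (T + T' + T'')"
proof -
  obtain t t' t'' where "t \<le> T" "t' \<le> T'" "t'' \<le> T''" "runs g s False s' t" "runs c s' True s'' t'"
    "runs (Loop g c) s'' b z t''"
    using assms unfolding runs_within_def by blast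
  then show ?thesis
    unfolding runs_within_def using runs_again by (intro exI[of _ "t + t' + t''"]) auto
qed

text \<open>\<open>s i\<close> and \<open>s' i\<close> are the states before and after the guard in
  round \<open>i\<close>. The last call is left as a hypothesis because it may end by either
  exit.\<close>

lemma runs_within_Loop:
  assumes "\<And>i. i < m \<Longrightarrow> runs_within g (s i) False (s' i) T"
    and "\<And>i. i < m \<Longrightarrow> runs_within c (s' i) True (s (Suc i)) T'"
    and "runs_within (Loop g c) (s m) b z T''"
  shows "runs_within (Loop g c) (s 0) b z (m * (T + T') + T'')"
  using assms
proof (induction m arbitrary: T'')
  case (Suc m)
  have "runs_within (Loop g c) (s m) b z (T + T' + T'')"
    using Suc.prems by (intro runs_within_Loop_again) auto
  from Suc.IH[OF _ _ this] Suc.prems show ?case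
    by (simp add: algebra_simps)
qed simp

definition succeed :: prog where
  "succeed = Act False (\<lambda>y. (y, Stay, True))"

definition fail :: prog where
  "fail = Act False (\<lambda>y. (y, Stay, False))"

definition test :: "bool \<Rightarrow> (letter cell \<Rightarrow> bool) \<Rightarrow> prog" where
  "test e P = Act e (\<lambda>y. (y, Stay, P y))"

definition move :: "bool \<Rightarrow> direction \<Rightarrow> prog" where
  "move e d = Act e (\<lambda>y. (y, d, True))"

definition rewrite :: "bool \<Rightarrow> (letter cell \<Rightarrow> letter cell) \<Rightarrow> prog" where
  "rewrite e h = Act e (\<lambda>y. (h y, Stay, True))"

definition seq :: "prog \<Rightarrow> prog \<Rightarrow> prog" where
  "seq p q = Cond p q q"

text \<open>\<open>q\<close> restores the heads. It occurs in both branches, so the result of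
  \<open>p\<close> is remembered in the control state while \<open>q\<close> runs.\<close>

definition cleanup :: "prog \<Rightarrow> prog \<Rightarrow> prog" where
  "cleanup p q = Cond p (seq q succeed) (seq q fail)"

lemma act_at_Stay: "act_at e (read_at e s, Stay) s = s"
proof -
  obtain t u where "s = (t, u)" by (rule prod.exhaust)
  then show ?thesis by (simp add: act_tape_Stay)
qed

lemma runs_succeed: "runs_within succeed s True s 1"
  unfolding succeed_def by (rule runs_within_Act[OF refl]) (simp add: act_at_Stay)

lemma runs_fail: "runs_within fail s False s 1"
  unfolding fail_def by (rule runs_within_Act[OF refl]) (simp add: act_at_Stay)

lemma runs_test: "b = P (read_at e s) \<Longrightarrow> runs_within (test e P) s b s 1"
  unfolding test_def by (rule runs_within_Act[OF _ act_at_Stay[symmetric]]) simp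

lemma runs_move: "s' = act_at e (read_at e s, d) s \<Longrightarrow> runs_within (move e d) s True s' 1"
  unfolding move_def by (rule runs_within_Act) simp_all

lemma runs_rewrite: "s' = act_at e (h (read_at e s), Stay) s \<Longrightarrow> runs_within (rewrite e h) s True s' 1"
  unfolding rewrite_def by (rule runs_within_Act) simp_all

lemma runs_seq:
  "runs_within p s b' s' T \<Longrightarrow> runs_within q s' b s'' T' \<Longrightarrow> runs_within (seq p q) s b s'' (T + T')"
  unfolding seq_def by (rule runs_within_Cond) simp_all

lemma runs_cleanup:
  assumes "runs_within p s b s' T" and "runs_within q s' b' s'' T'"
  shows "runs_within (cleanup p q) s b s'' (T + T' + 1)"
proof -
  have "runs_within (if b then seq q succeed else seq q fail) s' b s'' (T' + 1)"
    using runs_seq[OF assms(2) runs_succeed] runs_seq[OF assms(2) runs_fail] by simp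
  from runs_within_Cond[OF assms(1) this] show ?thesis
    by (simp add: cleanup_def)
qed

section \<open>Sets of marks in the cells of the second tape\<close>

definition mark_tape :: "nat \<Rightarrow> (nat \<Rightarrow> nat set) \<Rightarrow> int \<Rightarrow> letter cell" where
  "mark_tape N A i = (if 0 \<le> i \<and> i < int N then Aux (set_encode (A (nat i))) else Blank)"

definition conf :: "letter list \<Rightarrow> (nat \<Rightarrow> nat set) \<Rightarrow> int \<Rightarrow> int \<Rightarrow> tapes" where
  "conf w A h k = ((fst (input_tape w), h), (mark_tape (length w) A, k))"

fun marks :: "letter cell \<Rightarrow> nat set" where
  "marks (Aux m) = set_decode m"
| "marks _ = {}"

fun map_marks :: "(nat set \<Rightarrow> nat set) \<Rightarrow> letter cell \<Rightarrow> letter cell" where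
  "map_marks f (Aux m) = Aux (set_encode (f (set_decode m)))"
| "map_marks f y = y"

lemma read_conf_input:
  "read_at False (conf w A h k) =
    (if 0 \<le> h \<and> h < int (length w) then Inp (w ! nat h) else Blank)"
  by (simp add: conf_def input_tape_def read_tape_def)

lemma read_conf_marks: "read_at True (conf w A h k) = mark_tape (length w) A k"
  by (simp add: conf_def read_tape_def)

lemma marks_mark_tape:
  "(\<And>i. finite (A i)) \<Longrightarrow>
    marks (mark_tape N A k) = (if 0 \<le> k \<and> k < int N then A (nat k) else {})"
  by (simp add: mark_tape_def)

lemma mark_tape_eq_Blank: "mark_tape N A k = Blank \<longleftrightarrow> \<not> (0 \<le> k \<and> k < int N)"
  by (simp add: mark_tape_def)

lemma runs_move_input:
  "runs_within (move False d) (conf w A h k) True (conf w A (move_head d h) k) 1"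
  by (rule runs_move) (simp add: conf_def read_tape_def)

lemma runs_move_marks:
  "runs_within (move True d) (conf w A h k) True (conf w A h (move_head d k)) 1"
  by (rule runs_move) (simp add: conf_def read_tape_def)

text \<open>The head may start on the blank to the right of the word; the move left made before any
  test keeps that blank from being taken for the one at position -1.\<close>

definition rewind :: "bool \<Rightarrow> prog" where
  "rewind e = seq (move e Move_Left)
    (seq (Loop (test e (\<lambda>y. y = Blank)) (move e Move_Left)) (move e Move_Right))"

lemma runs_rewind_marks:
  assumes "k \<le> length w"
  shows "runs_within (rewind True) (conf w A h (int k)) True (conf w A h 0) (2 * length w + 3)"
proof -
  have loop: "runs_within (Loop (test True (\<lambda>y. y = Blank)) (move True Move_Left))
      (conf w A h (int k - 1 - int 0)) True (conf w A h (-1)) (k * (1 + 1) + 1)"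
  proof (rule runs_within_Loop)
    fix i assume "i < k"
    then show "runs_within (test True (\<lambda>y. y = Blank)) (conf w A h (int k - 1 - int i)) False
        (conf w A h (int k - 1 - int i)) 1"
      using assms by (intro runs_test) (simp add: read_conf_marks mark_tape_eq_Blank)
    show "runs_within (move True Move_Left) (conf w A h (int k - 1 - int i)) True
        (conf w A h (int k - 1 - int (Suc i))) 1"
      using runs_move_marks[of Move_Left w A h "int k - 1 - int i"] by (simp add: algebra_simps)
  next
    show "runs_within (Loop (test True (\<lambda>y. y = Blank)) (move True Move_Left))
      (conf w A h (int k - 1 - int k)) True (conf w A h (-1)) 1"
      using runs_test[of True "\<lambda>y. y = Blank" True "conf w A h (-1)"]
      by (intro runs_within_Loop_found) (simp add: read_conf_marks mark_tape_eq_Blank)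
  qed
  have left: "runs_within (move True Move_Left) (conf w A h (int k)) True (conf w A h (int k - 1 - int 0)) 1"
    using runs_move_marks[of Move_Left w A h "int k"] by simp
  have right: "runs_within (move True Move_Right) (conf w A h (-1)) True (conf w A h 0) 1"
    using runs_move_marks[of Move_Right w A h "-1"] by simp
  from runs_seq[OF left runs_seq[OF loop right]] show ?thesis
    unfolding rewind_def by (rule runs_within_mono) (use assms in simp)
qed

lemma runs_rewind_input:
  assumes "h \<le> length w"
  shows "runs_within (rewind False) (conf w A (int h) k) True (conf w A 0 k) (2 * length w + 3)"
proof -
  have loop: "runs_within (Loop (test False (\<lambda>y. y = Blank)) (move False Move_Left))
      (conf w A (int h - 1 - int 0) k) True (conf w A (-1) k) (h * (1 + 1) + 1)"
  proof (rule runs_within_Loop)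
    fix i assume "i < h"
    then show "runs_within (test False (\<lambda>y. y = Blank)) (conf w A (int h - 1 - int i) k) False
        (conf w A (int h - 1 - int i) k) 1"
      using assms by (intro runs_test) (simp add: read_conf_input)
    show "runs_within (move False Move_Left) (conf w A (int h - 1 - int i) k) True
        (conf w A (int h - 1 - int (Suc i)) k) 1"
      using runs_move_input[of Move_Left w A "int h - 1 - int i" k] by (simp add: algebra_simps)
  next
    show "runs_within (Loop (test False (\<lambda>y. y = Blank)) (move False Move_Left))
      (conf w A (int h - 1 - int h) k) True (conf w A (-1) k) 1"
      using runs_test[of True "\<lambda>y. y = Blank" False "conf w A (-1) k"]
      by (intro runs_within_Loop_found) (simp add: read_conf_input)
  qed
  have left: "runs_within (move False Move_Left) (conf w A (int h) k) True (conf w A (int h - 1 - int 0) k) 1"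
    using runs_move_input[of Move_Left w A "int h" k] by simp
  have right: "runs_within (move False Move_Right) (conf w A (-1) k) True (conf w A 0 k) 1"
    using runs_move_input[of Move_Right w A "-1" k] by simp
  from runs_seq[OF left runs_seq[OF loop right]] show ?thesis
    unfolding rewind_def by (rule runs_within_mono) (use assms in simp)
qed

definition at_mark :: "nat \<Rightarrow> prog" where
  "at_mark x = test True (\<lambda>y. x \<in> marks y)"

lemma runs_at_mark:
  assumes "\<And>i. finite (A i)" and "k < length w" and "b \<longleftrightarrow> x \<in> A k"
  shows "runs_within (at_mark x) (conf w A h (int k)) b (conf w A h (int k)) 1"
  unfolding at_mark_def using assms by (intro runs_test) (simp add: read_conf_marks marks_mark_tape)

definition seek :: "nat \<Rightarrow> prog" where
  "seek x = Loop (at_mark x) (move True Move_Right)"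

lemma runs_seek:
  assumes "\<And>i. finite (A i)" and "k < length w" and "x \<in> A k" and "\<And>i. i < k \<Longrightarrow> x \<notin> A i"
  shows "runs_within (seek x) (conf w A h 0) True (conf w A h (int k)) (2 * length w + 1)"
proof -
  have "runs_within (seek x) (conf w A h (int 0)) True (conf w A h (int k)) (k * (1 + 1) + 1)"
    unfolding seek_def
  proof (rule runs_within_Loop[where s = "\<lambda>i. conf w A h (int i)"])
    fix i assume "i < k"
    with assms show "runs_within (at_mark x) (conf w A h (int i)) False (conf w A h (int i)) 1"
      by (intro runs_at_mark) auto
    show "runs_within (move True Move_Right) (conf w A h (int i)) True (conf w A h (int (Suc i))) 1"
      using runs_move_marks[of Move_Right w A h "int i"] by (simp add: algebra_simps)
  next
    show "runs_within (Loop (at_mark x) (move True Move_Right)) (conf w A h (int k)) True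
        (conf w A h (int k)) 1"
      using assms by (intro runs_within_Loop_found runs_at_mark) auto
  qed
  then show ?thesis
    using assms by (auto elim!: runs_within_mono)
qed

definition change :: "(nat set \<Rightarrow> nat set) \<Rightarrow> prog" where
  "change f = rewrite True (map_marks f)"

lemma runs_change:
  assumes "\<And>i. finite (A i)" and "k < length w"
  shows "runs_within (change f) (conf w A h (int k)) True (conf w (A(k := f (A k))) h (int k)) 1"
proof -
  have "conf w (A(k := f (A k))) h (int k) =
      act_at True (map_marks f (mark_tape (length w) A (int k)), Stay) (conf w A h (int k))"
    using assms by (auto simp: conf_def mark_tape_def fun_eq_iff)
  then show ?thesis
    unfolding change_def by (intro runs_rewrite) (simp add: read_conf_marks)
qed

text \<open>Mark 0 represents a set of positions, and mark \<open>x\<close> with \<open>0 < x < num_marks\<close> the value of the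
  variable \<open>x\<close>.\<close>

definition num_marks :: nat where
  "num_marks = 8"

definition layout :: "(nat \<Rightarrow> nat) \<Rightarrow> nat set \<Rightarrow> nat \<Rightarrow> nat set" where
  "layout \<sigma> S i = {x. 0 < x \<and> x < num_marks \<and> \<sigma> x = i} \<union> (if i \<in> S then {0} else {})"

definition state :: "letter list \<Rightarrow> (nat \<Rightarrow> nat) \<Rightarrow> nat set \<Rightarrow> tapes" where
  "state w \<sigma> S = conf w (layout \<sigma> S) 0 0"

definition is_var :: "nat \<Rightarrow> bool" where
  "is_var x \<longleftrightarrow> 0 < x \<and> x < num_marks"

lemma finite_layout: "finite (layout \<sigma> S i)"
  by (rule finite_subset[of _ "{..<num_marks}"]) (auto simp: layout_def num_marks_def)

text \<open>The deletion precedes the insertion, so the case \<open>i = j\<close> is covered as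
  well; it occurs when \<open>reset\<close> is applied to a variable that already is 0.\<close>

lemma layout_upd:
  assumes "is_var x" and "\<sigma> x = i"
  shows "(layout \<sigma> S)(i := layout \<sigma> S i - {x}, j := insert x (((layout \<sigma> S)(i := layout \<sigma> S i - {x})) j))
    = layout (\<sigma>(x := j)) S"
  using assms by (auto simp: fun_eq_iff layout_def is_var_def)

lemma runs_seek_var:
  assumes "is_var x" and "\<sigma> x < length w"
  shows "runs_within (seek x) (conf w (layout \<sigma> S) h 0) True (conf w (layout \<sigma> S) h (int (\<sigma> x)))
    (2 * length w + 1)"
  using assms by (intro runs_seek finite_layout) (auto simp: layout_def is_var_def)

definition has :: "nat \<Rightarrow> nat \<Rightarrow> prog" where
  "has y x = cleanup (seq (seek x) (at_mark y)) (rewind True)"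

lemma runs_has:
  assumes "is_var x" and "\<sigma> x < length w"
  shows "runs_within (has y x) (state w \<sigma> S) (y \<in> layout \<sigma> S (\<sigma> x)) (state w \<sigma> S) (4 * length w + 6)"
  unfolding has_def state_def
  using assms
  by (intro runs_within_mono[OF runs_cleanup[OF runs_seq[OF runs_seek_var runs_at_mark]
        runs_rewind_marks]]) (auto intro: finite_layout)

definition assign_set :: "bool \<Rightarrow> nat \<Rightarrow> prog" where
  "assign_set b x = seq (seek x) (seq (change (\<lambda>A. if b then insert 0 A else A - {0})) (rewind True))"

lemma runs_assign_set:
  assumes "is_var x" and "\<sigma> x < length w"
  shows "runs_within (assign_set b x) (state w \<sigma> S) True
    (state w \<sigma> (if b then insert (\<sigma> x) S else S - {\<sigma> x})) (4 * length w + 5)"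
proof -
  have eq: "(layout \<sigma> S)(\<sigma> x := (\<lambda>A. if b then insert 0 A else A - {0}) (layout \<sigma> S (\<sigma> x))) =
      layout \<sigma> (if b then insert (\<sigma> x) S else S - {\<sigma> x})"
    by (auto simp: fun_eq_iff layout_def)
  show ?thesis
    unfolding assign_set_def state_def eq[symmetric]
    using assms
    by (intro runs_within_mono[OF runs_seq[OF runs_seek_var runs_seq[OF runs_change
        runs_rewind_marks]]]) (auto intro: finite_layout)
qed

definition reset :: "nat \<Rightarrow> prog" where
  "reset x = seq (seek x) (seq (change (\<lambda>A. A - {x})) (seq (rewind True) (change (insert x))))"

lemma runs_reset:
  assumes "is_var x" and "\<sigma> x < length w"
  shows "runs_within (reset x) (state w \<sigma> S) True (state w (\<sigma>(x := 0)) S) (4 * length w + 6)"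
proof -
  let ?A = "layout \<sigma> S"
  let ?B = "?A(\<sigma> x := ?A (\<sigma> x) - {x})"
  have fin: "finite (?B i)" for i
    by (simp add: finite_layout)
  have "0 < length w" using assms by linarith
  then have insert: "runs_within (change (insert x)) (conf w ?B 0 0) True
      (conf w (?B(0 := insert x (?B 0))) 0 0) 1"
    using runs_change[where k = 0 and A = ?B and f = "insert x" and h = 0, OF fin] by simp
  have rewind: "runs_within (rewind True) (conf w ?B 0 (int (\<sigma> x))) True (conf w ?B 0 0)
      (2 * length w + 3)"
    using assms by (intro runs_rewind_marks) simp
  have delete: "runs_within (change (\<lambda>A. A - {x})) (conf w ?A 0 (int (\<sigma> x))) True
      (conf w ?B 0 (int (\<sigma> x))) 1"
    using assms by (intro runs_change finite_layout) simp
  from runs_seq[OF runs_seek_var[of x \<sigma>, OF assms] runs_seq[OF delete runs_seq[OF rewind insert]]]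
  show ?thesis
    unfolding reset_def state_def layout_upd[OF assms(1) refl, symmetric]
    by (rule runs_within_mono) simp
qed

text \<open>The cell to the right is inspected before the mark is touched: at the last position the
  tape stays as it was, and \<open>reset\<close> can still find the mark.\<close>

definition advance :: "nat \<Rightarrow> prog" where
  "advance x = seq (seek x) (seq (move True Move_Right)
    (Cond (test True (\<lambda>y. y = Blank)) (seq (rewind True) fail)
      (seq (move True Move_Left) (seq (change (\<lambda>A. A - {x})) (seq (move True Move_Right)
        (seq (change (insert x)) (seq (rewind True) succeed)))))))"

lemma runs_advance_last:
  assumes "is_var x" and "\<sigma> x = length w - 1" and "w \<noteq> []"
  shows "runs_within (advance x) (state w \<sigma> S) False (state w \<sigma> S) (4 * length w + 13)"
proof -
  let ?c = "\<lambda>k. conf w (layout \<sigma> S) 0 k"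
  have seek: "runs_within (seek x) (?c 0) True (?c (int (\<sigma> x))) (2 * length w + 1)"
    using assms by (intro runs_seek_var) auto
  have right: "runs_within (move True Move_Right) (?c (int (\<sigma> x))) True (?c (int (length w))) 1"
    using runs_move_marks[of Move_Right w "layout \<sigma> S" 0 "int (\<sigma> x)"] assms
    by (cases w) (simp_all add: algebra_simps)
  have over: "runs_within (test True (\<lambda>y. y = Blank)) (?c (int (length w))) True (?c (int (length w))) 1"
    by (intro runs_test) (simp add: read_conf_marks mark_tape_eq_Blank)
  have stop: "runs_within (seq (rewind True) fail) (?c (int (length w))) False (?c 0)
      (2 * length w + 3 + 1)"
    by (rule runs_seq[OF runs_rewind_marks runs_fail]) simp
  have "runs_within (advance x) (?c 0) False (?c 0)
      ((2 * length w + 1) + (1 + (1 + (2 * length w + 3 + 1))))"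
    unfolding advance_def using stop
    by (intro runs_seq[OF seek runs_seq[OF right runs_within_Cond[OF over]]]) simp
  then show ?thesis
    unfolding state_def by (rule runs_within_mono) simp
qed

lemma runs_advance:
  assumes "is_var x" and "Suc (\<sigma> x) < length w"
  shows "runs_within (advance x) (state w \<sigma> S) True (state w (\<sigma>(x := Suc (\<sigma> x))) S) (4 * length w + 13)"
proof -
  let ?A = "layout \<sigma> S"
  let ?B = "?A(\<sigma> x := ?A (\<sigma> x) - {x})"
  let ?C = "?B(Suc (\<sigma> x) := insert x (?B (Suc (\<sigma> x))))"
  have fin: "finite (?B i)" for i
    by (simp add: finite_layout)
  have right: "runs_within (move True Move_Right) (conf w A 0 (int (\<sigma> x))) True
      (conf w A 0 (int (Suc (\<sigma> x)))) 1" for A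
    using runs_move_marks[of Move_Right w A 0 "int (\<sigma> x)"] by (simp add: algebra_simps)
  have left: "runs_within (move True Move_Left) (conf w A 0 (int (Suc (\<sigma> x)))) True
      (conf w A 0 (int (\<sigma> x))) 1" for A
    using runs_move_marks[of Move_Left w A 0 "int (Suc (\<sigma> x))"] by (simp add: algebra_simps)
  have seek: "runs_within (seek x) (conf w ?A 0 0) True (conf w ?A 0 (int (\<sigma> x))) (2 * length w + 1)"
    using assms by (intro runs_seek_var) auto
  have more: "runs_within (test True (\<lambda>y. y = Blank)) (conf w ?A 0 (int (Suc (\<sigma> x)))) False
      (conf w ?A 0 (int (Suc (\<sigma> x)))) 1"
    using assms by (intro runs_test) (simp add: read_conf_marks mark_tape_eq_Blank)
  have delete: "runs_within (change (\<lambda>A. A - {x})) (conf w ?A 0 (int (\<sigma> x))) True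
      (conf w ?B 0 (int (\<sigma> x))) 1"
    using assms by (intro runs_change finite_layout) simp
  have insert: "runs_within (change (insert x)) (conf w ?B 0 (int (Suc (\<sigma> x)))) True
      (conf w ?C 0 (int (Suc (\<sigma> x)))) 1"
    using assms by (intro runs_change fin) simp
  have rewind: "runs_within (rewind True) (conf w ?C 0 (int (Suc (\<sigma> x)))) True (conf w ?C 0 0)
      (2 * length w + 3)"
    using assms by (intro runs_rewind_marks) simp
  note update = runs_seq[OF left runs_seq[OF delete runs_seq[OF right runs_seq[OF insert
        runs_seq[OF rewind runs_succeed]]]]]
  have "runs_within (advance x) (conf w ?A 0 0) True (conf w ?C 0 0)
      ((2 * length w + 1) + (1 + (1 + (1 + (1 + (1 + (1 + (2 * length w + 3 + 1))))))))"
    unfolding advance_def using update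
    by (intro runs_seq[OF seek runs_seq[OF right runs_within_Cond[OF more]]]) simp
  then show ?thesis
    unfolding state_def layout_upd[OF assms(1) refl, symmetric] by (rule runs_within_mono) simp
qed

section \<open>Loops over all positions\<close>

definition each :: "nat \<Rightarrow> prog \<Rightarrow> prog" where
  "each x p = cleanup (Loop p (advance x)) (reset x)"

text \<open>\<open>S i\<close> is the set represented on the tape before round \<open>i\<close>,
  which the body may change. A success ends the loop early and only some \<open>S m\<close> is
  promised; without success all rounds take place and \<open>m\<close> is the length. A body that
  always fails thus turns the search into an unconditional loop. The variable starts at 0 and is put
  back there, ready for its next use.\<close>

lemma runs_each:
  assumes x: "is_var x" "\<sigma> x = 0" and w: "w \<noteq> []"
    and body: "\<And>i. i < length w \<Longrightarrow>
      runs_within p (state w (\<sigma>(x := i)) (S i)) (B i) (state w (\<sigma>(x := i)) (S (Suc i))) T"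
  shows "\<exists>m. ((\<exists>i<length w. B i) \<or> m = length w) \<and>
    runs_within (each x p) (state w \<sigma> (S 0)) (\<exists>i<length w. B i) (state w \<sigma> (S m))
      (length w * (T + (4 * length w + 13)) + (4 * length w + 7))"
proof -
  let ?N = "length w" and ?T' = "4 * length w + 13"
  let ?s = "\<lambda>i. state w (\<sigma>(x := i)) (S i)" and ?s' = "\<lambda>i. state w (\<sigma>(x := i)) (S (Suc i))"
  \<comment> \<open>The round in which the loop ends: that of the first success, or else the last
    one. The set left behind is therefore \<open>S (Suc m)\<close>.\<close>
  define m where "m = (if \<exists>i<?N. B i then LEAST i. i < ?N \<and> B i else ?N - 1)"
  have m: "m < ?N" "\<And>i. i < m \<Longrightarrow> \<not> B i" "B m \<longleftrightarrow> (\<exists>i<?N. B i)"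
  proof -
    show "m < ?N"
      using w LeastI_ex[of "\<lambda>i. i < ?N \<and> B i"] by (auto simp: m_def)
    then show "\<not> B i" if "i < m" for i
      using that not_less_Least[of i "\<lambda>i. i < ?N \<and> B i"] by (auto simp: m_def split: if_splits)
    show "B m \<longleftrightarrow> (\<exists>i<?N. B i)"
      using w LeastI_ex[of "\<lambda>i. i < ?N \<and> B i"] by (auto simp: m_def)
  qed
  have last: "\<not> B m \<Longrightarrow> Suc m = ?N"
    using m(3) w by (auto simp: m_def)
  have stop: "runs_within (Loop p (advance x)) (?s m) (B m) (?s' m) (T + ?T')"
  proof (cases "B m")
    case True
    then show ?thesis
      using body[OF m(1)] by (auto intro: runs_within_mono[OF runs_within_Loop_found])
  next
    case False
    then have "runs_within (advance x) (?s' m) False (?s' m) ?T'"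
      using last w x by (intro runs_advance_last) auto
    with False body[OF m(1)] show ?thesis
      by (auto intro: runs_within_Loop_exhausted)
  qed
  have "runs_within (Loop p (advance x)) (?s 0) (B m) (?s' m) (m * (T + ?T') + (T + ?T'))"
  proof (rule runs_within_Loop[where s = ?s and s' = ?s' and m = m, OF _ _ stop])
    fix i assume i: "i < m"
    then show "runs_within p (?s i) False (?s' i) T"
      using body[of i] m by simp
    show "runs_within (advance x) (?s' i) True (?s (Suc i)) ?T'"
      using runs_advance[of x "\<sigma>(x := i)" w "S (Suc i)"] x m(1) i by simp
  qed
  moreover have "runs_within (reset x) (?s' m) True (state w \<sigma> (S (Suc m))) (4 * ?N + 6)"
    using runs_reset[of x "\<sigma>(x := m)" w "S (Suc m)"] x m(1) by (simp add: fun_upd_idem)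
  moreover have "?s 0 = state w \<sigma> (S 0)"
    using x by (simp add: fun_upd_idem)
  ultimately have "runs_within (each x p) (state w \<sigma> (S 0)) (B m) (state w \<sigma> (S (Suc m)))
      (m * (T + ?T') + (T + ?T') + (4 * ?N + 6) + 1)"
    unfolding each_def using runs_cleanup by metis
  moreover have "m * (T + ?T') + (T + ?T') + (4 * ?N + 6) + 1 \<le> ?N * (T + ?T') + (4 * ?N + 7)"
  proof -
    have "Suc m * (T + ?T') \<le> ?N * (T + ?T')"
      using m(1) by (intro mult_le_mono1) simp
    then show ?thesis by simp
  qed
  ultimately show ?thesis
    using m(3) last by (intro exI[of _ "Suc m"]) (auto intro: runs_within_mono)
qed

section \<open>Reading a letter at a given field and offset\<close>

text \<open>The letter at offset \<open>j\<close> of the \<open>f\<close>-th field of a word, where every field extends up to and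
  including its separator.\<close>

fun field_letter :: "letter list \<Rightarrow> nat \<Rightarrow> nat \<Rightarrow> letter option" where
  "field_letter [] f j = None"
| "field_letter (a # w) 0 0 = Some a"
| "field_letter (a # w) 0 (Suc j) = (if a = Sep then None else field_letter w 0 j)"
| "field_letter (a # w) (Suc f) j = field_letter w (if a = Sep then f else Suc f) j"

lemma field_letter_0:
  "field_letter w 0 j =
    (if j \<le> length (takeWhile (\<lambda>a. a \<noteq> Sep) w) \<and> j < length w then Some (w ! j) else None)"
proof (induction w arbitrary: j)
  case (Cons a w)
  then show ?case by (cases j) auto
qed simp

lemma field_letter_Suc:
  "field_letter w (Suc f) j = field_letter (drop (Suc (length (takeWhile (\<lambda>a. a \<noteq> Sep) w))) w) f j"
  by (induction w) auto

definition field_end :: "letter list \<Rightarrow> nat \<Rightarrow> nat" where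
  "field_end w h = h + length (takeWhile (\<lambda>a. a \<noteq> Sep) (drop h w))"

text \<open>The cap keeps the head on the first blank once the word has run out of fields;
  \<open>field_letter\<close> of the empty remainder is \<open>None\<close>, as it should be
  there.\<close>

definition next_field :: "letter list \<Rightarrow> nat \<Rightarrow> nat" where
  "next_field w h = min (length w) (Suc (field_end w h))"

lemma field_end_le: "h \<le> length w \<Longrightarrow> field_end w h \<le> length w"
  using length_takeWhile_le[of "\<lambda>a. a \<noteq> Sep" "drop h w"] by (simp add: field_end_def)

lemma next_field_le: "next_field w h \<le> length w"
  by (simp add: next_field_def)

lemma field_letter_next_field:
  "field_letter (drop h w) (Suc f) j = field_letter (drop (next_field w h) w) f j"
  by (cases "Suc (field_end w h) \<le> length w")
    (simp_all add: field_letter_Suc next_field_def field_end_def add.commute min_def)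

lemma field_end_nth: "h \<le> i \<Longrightarrow> i < field_end w h \<Longrightarrow> i < length w \<and> w ! i \<noteq> Sep"
proof -
  assume h: "h \<le> i" "i < field_end w h"
  let ?u = "takeWhile (\<lambda>a. a \<noteq> Sep) (drop h w)"
  have i: "i - h < length ?u"
    using h by (simp add: field_end_def)
  then have "i - h < length (drop h w)"
    using length_takeWhile_le less_le_trans by blast
  moreover have "?u ! (i - h) = w ! i"
    using i h calculation by (simp add: takeWhile_nth)
  moreover have "?u ! (i - h) \<noteq> Sep"
    using nth_mem[OF i] set_takeWhileD by metis
  ultimately show ?thesis by simp
qed

lemma nth_field_end: "h \<le> length w \<Longrightarrow> field_end w h < length w \<Longrightarrow> w ! field_end w h = Sep"
  using nth_length_takeWhile[of "\<lambda>a. a \<noteq> Sep" "drop h w"] by (simp add: field_end_def)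

definition at_end :: prog where
  "at_end = test False (\<lambda>y. y = Inp Sep \<or> y = Blank)"

lemma runs_at_end:
  assumes "h \<le> i" and "i \<le> field_end w h" and "h \<le> length w"
  shows "runs_within at_end (conf w A (int i) k) (i = field_end w h) (conf w A (int i) k) 1"
  unfolding at_end_def
proof (rule runs_test)
  show "(i = field_end w h) \<longleftrightarrow> read_at False (conf w A (int i) k) = Inp Sep \<or>
      read_at False (conf w A (int i) k) = Blank"
    using assms field_end_nth[of h i w] nth_field_end[of h w] field_end_le[of h w]
    by (cases "i = field_end w h"; cases "i < length w") (auto simp: read_conf_input)
qed

definition skip_field :: prog where
  "skip_field = seq (Loop at_end (move False Move_Right))
    (Cond (test False (\<lambda>y. y = Blank)) succeed (move False Move_Right))"

lemma runs_skip_field: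
  assumes "h \<le> length w"
  shows "runs_within skip_field (conf w A (int h) k) True (conf w A (int (next_field w h)) k)
    (2 * length w + 3)"
proof -
  let ?e = "field_end w h"
  have he: "h \<le> ?e" by (simp add: field_end_def)
  have "runs_within (Loop at_end (move False Move_Right)) (conf w A (int (h + 0)) k) True
      (conf w A (int ?e) k) ((?e - h) * (1 + 1) + 1)"
  proof (rule runs_within_Loop[where s = "\<lambda>i. conf w A (int (h + i)) k"])
    fix i assume i: "i < ?e - h"
    then have "h + i \<le> ?e" "h + i \<noteq> ?e"
      by linarith+
    with runs_at_end[of h "h + i" w A k] assms
    show "runs_within at_end (conf w A (int (h + i)) k) False (conf w A (int (h + i)) k) 1"
      by simp
    show "runs_within (move False Move_Right) (conf w A (int (h + i)) k) True
        (conf w A (int (h + Suc i)) k) 1"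
      using runs_move_input[of Move_Right w A "int (h + i)" k] by (simp add: algebra_simps)
  next
    show "runs_within (Loop at_end (move False Move_Right)) (conf w A (int (h + (?e - h))) k) True
        (conf w A (int ?e) k) 1"
      using runs_within_Loop_found runs_at_end[of h ?e w A k] assms he by simp
  qed
  then have loop: "runs_within (Loop at_end (move False Move_Right)) (conf w A (int h) k) True
      (conf w A (int ?e) k) (2 * length w + 1)"
    using field_end_le[OF assms] by (auto intro: runs_within_mono)
  have over: "runs_within (test False (\<lambda>y. y = Blank)) (conf w A (int ?e) k) (?e = length w)
      (conf w A (int ?e) k) 1"
    using field_end_le[OF assms] by (intro runs_test) (auto simp: read_conf_input)
  have "runs_within (if ?e = length w then succeed else move False Move_Right)
      (conf w A (int ?e) k) True (conf w A (int (next_field w h)) k) 1"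
  proof (cases "?e = length w")
    case True
    then show ?thesis
      using runs_succeed by (simp add: next_field_def)
  next
    case False
    then show ?thesis
      using runs_move_input[of Move_Right w A "int ?e" k] field_end_le[OF assms]
      by (simp add: next_field_def algebra_simps)
  qed
  from runs_seq[OF loop runs_within_Cond[OF over this]] show ?thesis
    unfolding skip_field_def by (rule runs_within_mono) simp
qed

text \<open>The mark of \<open>v\<close> serves as a unary counter: the second head moves one cell
  for every two fields skipped and meets the mark after \<open>\<sigma> v\<close> rounds.\<close>

definition goto_field :: "bool \<Rightarrow> nat \<Rightarrow> prog" where
  "goto_field b v = seq (Loop (at_mark v) (seq skip_field (seq skip_field (move True Move_Right))))
    (seq (rewind True) (if b then skip_field else succeed))"

lemma runs_goto_field:
  assumes v: "is_var v" "\<sigma> v < length w"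
  obtains h where "h \<le> length w"
    and "\<And>j. field_letter (drop h w) 0 j = field_letter w (2 * \<sigma> v + of_bool b) j"
    and "runs_within (goto_field b v) (conf w (layout \<sigma> S) 0 0) True (conf w (layout \<sigma> S) (int h) 0)
      (length w * (4 * length w + 8) + (4 * length w + 7))"
proof -
  let ?A = "layout \<sigma> S" and ?N = "length w"
  \<comment> \<open>The start of field \<open>2 * i\<close>, or the end of the word if there are
    fewer fields.\<close>
  let ?H = "\<lambda>i. (next_field w ^^ (2 * i)) 0"
  have H: "?H i \<le> ?N" for i
    by (cases i) (simp_all add: next_field_le)
  have Hf: "field_letter (drop ((next_field w ^^ i) 0) w) f j = field_letter w (i + f) j" for i f j
    by (induction i arbitrary: f) (simp_all flip: field_letter_next_field)
  have "runs_within (Loop (at_mark v) (seq skip_field (seq skip_field (move True Move_Right))))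
      (conf w ?A (int (?H 0)) (int 0)) True (conf w ?A (int (?H (\<sigma> v))) (int (\<sigma> v)))
      (\<sigma> v * (1 + ((2 * ?N + 3) + ((2 * ?N + 3) + 1))) + 1)"
  proof (rule runs_within_Loop[where s = "\<lambda>i. conf w ?A (int (?H i)) (int i)"])
    fix i assume "i < \<sigma> v"
    then show "runs_within (at_mark v) (conf w ?A (int (?H i)) (int i)) False
        (conf w ?A (int (?H i)) (int i)) 1"
      using v by (intro runs_at_mark finite_layout) (auto simp: layout_def is_var_def)
    have H_Suc: "?H (Suc i) = next_field w (next_field w (?H i))"
      by simp
    have "runs_within (move True Move_Right) (conf w ?A (int (?H (Suc i))) (int i)) True
        (conf w ?A (int (?H (Suc i))) (int (Suc i))) 1"
      using runs_move_marks[of Move_Right w ?A "int (?H (Suc i))" "int i"] by (simp add: algebra_simps)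
    from runs_seq[OF runs_skip_field[OF H] runs_seq[OF runs_skip_field[OF next_field_le] this[unfolded H_Suc]]]
    show "runs_within (seq skip_field (seq skip_field (move True Move_Right)))
        (conf w ?A (int (?H i)) (int i)) True (conf w ?A (int (?H (Suc i))) (int (Suc i)))
        ((2 * ?N + 3) + ((2 * ?N + 3) + 1))"
      unfolding H_Suc .
  next
    show "runs_within (Loop (at_mark v) (seq skip_field (seq skip_field (move True Move_Right))))
        (conf w ?A (int (?H (\<sigma> v))) (int (\<sigma> v))) True (conf w ?A (int (?H (\<sigma> v))) (int (\<sigma> v))) 1"
      using v by (intro runs_within_Loop_found runs_at_mark finite_layout)
        (auto simp: layout_def is_var_def)
  qed
  then have loop: "runs_within (Loop (at_mark v) (seq skip_field (seq skip_field (move True Move_Right))))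
      (conf w ?A 0 0) True (conf w ?A (int (?H (\<sigma> v))) (int (\<sigma> v)))
      (\<sigma> v * (4 * ?N + 8) + 1)"
    by (simp add: algebra_simps)
  have rew: "runs_within (rewind True) (conf w ?A (int (?H (\<sigma> v))) (int (\<sigma> v))) True
      (conf w ?A (int (?H (\<sigma> v))) 0) (2 * ?N + 3)"
    using v by (intro runs_rewind_marks) simp
  define h where "h = (next_field w ^^ (2 * \<sigma> v + of_bool b)) 0"
  have "runs_within (if b then skip_field else succeed) (conf w ?A (int (?H (\<sigma> v))) 0) True
      (conf w ?A (int h) 0) (2 * ?N + 3)"
    using runs_skip_field[OF H[of "\<sigma> v"], of ?A 0]
      runs_within_mono[OF runs_succeed[of "conf w ?A (int h) 0"], of "2 * ?N + 3"]
    by (cases b) (simp_all add: h_def)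
  from runs_seq[OF loop runs_seq[OF rew this]]
  have "runs_within (goto_field b v) (conf w ?A 0 0) True (conf w ?A (int h) 0)
      (?N * (4 * ?N + 8) + (4 * ?N + 7))"
    unfolding goto_field_def
  proof (rule runs_within_mono)
    have "\<sigma> v * (4 * ?N + 8) \<le> ?N * (4 * ?N + 8)"
      using v by (intro mult_le_mono1) simp
    then show "\<sigma> v * (4 * ?N + 8) + 1 + (2 * ?N + 3 + (2 * ?N + 3)) \<le> ?N * (4 * ?N + 8) + (4 * ?N + 7)"
      by linarith
  qed
  moreover have "h \<le> ?N"
    using H[of "\<sigma> v"] next_field_le by (cases b) (simp_all add: h_def)
  ultimately show thesis
    using Hf[of "2 * \<sigma> v + of_bool b" 0] by (intro that[of h]) (simp_all add: h_def)
qed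

text \<open>Both heads advance together until the second one meets the mark of \<open>j\<close> or
  the first one the end of the field. If the mark is met, the letter under the first head is the
  wanted one; it may be the separator itself, and a blank there matches no letter.\<close>

definition scan_field :: "nat \<Rightarrow> letter \<Rightarrow> prog" where
  "scan_field j a = seq
    (Loop (Cond (at_mark j) succeed at_end) (seq (move False Move_Right) (move True Move_Right)))
    (Cond (at_mark j) (test False (\<lambda>y. y = Inp a)) fail)"

lemma runs_scan_field:
  assumes j: "is_var j" "\<sigma> j < length w" and h: "h \<le> length w"
  obtains h' k where "h' \<le> length w" and "k \<le> length w"
    and "runs_within (scan_field j a) (conf w (layout \<sigma> S) (int h) 0)
      (field_letter (drop h w) 0 (\<sigma> j) = Some a) (conf w (layout \<sigma> S) (int h') (int k))
      (4 * length w + 4)"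
proof -
  let ?A = "layout \<sigma> S" and ?N = "length w" and ?d = "field_end w h - h"
  let ?s = "\<lambda>i. conf w ?A (int (h + i)) (int i)"
  have he: "h \<le> field_end w h" by (simp add: field_end_def)
  define m where "m = min (\<sigma> j) ?d"
  have m: "m \<le> \<sigma> j" "m \<le> ?d" "m < ?N" "h + m \<le> ?N"
    using j field_end_le[OF h] he by (auto simp: m_def)
  have mark: "runs_within (at_mark j) (?s i) (\<sigma> j = i) (?s i) 1" if "i < ?N" for i
    using j that by (intro runs_at_mark finite_layout) (auto simp: layout_def is_var_def)
  have "end": "runs_within at_end (?s i) (i = ?d) (?s i) 1" if "i \<le> ?d" for i
  proof -
    have "h + i \<le> field_end w h" "(i = ?d) = (h + i = field_end w h)"
      using that he by auto
    then show ?thesis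
      using runs_at_end[of h "h + i" w ?A "int i"] h by (simp only: le_add1 simp_thms)
  qed
  have guard: "runs_within (Cond (at_mark j) succeed at_end) (?s i) (\<sigma> j = i \<or> i = ?d) (?s i) (1 + 1)"
    if "i \<le> m" for i
  proof (rule runs_within_Cond[OF mark])
    show "i < ?N" using that m by simp
    show "runs_within (if \<sigma> j = i then succeed else at_end) (?s i) (\<sigma> j = i \<or> i = ?d) (?s i) 1"
      using runs_succeed[of "?s i"] "end"[of i] that m(2) by (cases "\<sigma> j = i") simp_all
  qed
  have loop: "runs_within (Loop (Cond (at_mark j) succeed at_end) (seq (move False Move_Right) (move True Move_Right)))
      (?s 0) True (?s m) (m * ((1 + 1) + (1 + 1)) + (1 + 1))"
  proof (rule runs_within_Loop[where s = ?s])
    fix i assume i: "i < m"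
    then have "\<not> (\<sigma> j = i \<or> i = ?d)"
      using m by auto
    then show "runs_within (Cond (at_mark j) succeed at_end) (?s i) False (?s i) (1 + 1)"
      using guard[of i] i by simp
    have "runs_within (move False Move_Right) (?s i) True (conf w ?A (int (h + Suc i)) (int i)) 1"
      using runs_move_input[of Move_Right w ?A "int (h + i)" "int i"] by (simp add: algebra_simps)
    moreover have "runs_within (move True Move_Right) (conf w ?A (int (h + Suc i)) (int i)) True (?s (Suc i)) 1"
      using runs_move_marks[of Move_Right w ?A "int (h + Suc i)" "int i"] by (simp add: algebra_simps)
    ultimately show "runs_within (seq (move False Move_Right) (move True Move_Right)) (?s i) True (?s (Suc i)) (1 + 1)"
      by (rule runs_seq)
  next
    have "\<sigma> j = m \<or> m = ?d"
      by (auto simp: m_def)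
    then show "runs_within (Loop (Cond (at_mark j) succeed at_end) (seq (move False Move_Right) (move True Move_Right)))
        (?s m) True (?s m) (1 + 1)"
      using runs_within_Loop_found guard[of m] by simp
  qed
  have "runs_within (if \<sigma> j = m then test False (\<lambda>y. y = Inp a) else fail) (?s m)
      (field_letter (drop h w) 0 (\<sigma> j) = Some a) (?s m) 1"
  proof (cases "\<sigma> j = m")
    case True
    then have "field_letter (drop h w) 0 (\<sigma> j) = Some a \<longleftrightarrow> read_at False (?s m) = Inp a"
      using m h by (auto simp: field_letter_0 read_conf_input field_end_def simp del: of_nat_add)
    with True show ?thesis
      by (simp only: if_True refl) (rule runs_test, rule refl)
  next
    case False
    then have "?d < \<sigma> j"
      by (auto simp: m_def)
    then show ?thesis
      using False runs_fail[of "?s m"] by (simp add: field_letter_0 field_end_def)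
  qed
  from runs_seq[OF loop runs_within_Cond[OF mark[OF m(3)] this]]
  have "runs_within (scan_field j a) (conf w ?A (int h) 0)
      (field_letter (drop h w) 0 (\<sigma> j) = Some a) (?s m) (4 * ?N + 4)"
    unfolding scan_field_def using m(3) by (auto intro: runs_within_mono)
  then show thesis
    using m by (intro that[of "h + m" m]) auto
qed

definition field_test :: "bool \<Rightarrow> nat \<Rightarrow> nat \<Rightarrow> letter \<Rightarrow> prog" where
  "field_test b v j a =
    cleanup (seq (goto_field b v) (scan_field j a)) (seq (rewind False) (rewind True))"

lemma runs_field_test:
  assumes "is_var v" "\<sigma> v < length w" "is_var j" "\<sigma> j < length w"
  shows "runs_within (field_test b v j a) (state w \<sigma> S)
    (field_letter w (2 * \<sigma> v + of_bool b) (\<sigma> j) = Some a) (state w \<sigma> S)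
    (length w * (4 * length w + 8) + (12 * length w + 18))"
proof -
  obtain h where h: "h \<le> length w"
    "\<And>j. field_letter (drop h w) 0 j = field_letter w (2 * \<sigma> v + of_bool b) j"
    "runs_within (goto_field b v) (conf w (layout \<sigma> S) 0 0) True (conf w (layout \<sigma> S) (int h) 0)
      (length w * (4 * length w + 8) + (4 * length w + 7))"
    using runs_goto_field[of v \<sigma> w b S] assms by blast
  obtain h' k where h': "h' \<le> length w" and k: "k \<le> length w"
    and scan: "runs_within (scan_field j a) (conf w (layout \<sigma> S) (int h) 0)
      (field_letter (drop h w) 0 (\<sigma> j) = Some a) (conf w (layout \<sigma> S) (int h') (int k))
      (4 * length w + 4)"
    using runs_scan_field[of j \<sigma> w h a S] assms h by blast
  from runs_cleanup[OF runs_seq[OF h(3) scan] runs_seq[OF runs_rewind_input[OF h'] runs_rewind_marks[OF k]]]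
  show ?thesis
    unfolding field_test_def state_def h(2) by (rule runs_within_mono) simp
qed

section \<open>First-order formulas and least fixed points in polynomial time\<close>

definition poly_bounded :: "(nat \<Rightarrow> nat) \<Rightarrow> bool" where
  "poly_bounded T \<longleftrightarrow> (\<exists>p. \<forall>n. T n \<le> poly p n)"

lemma poly_bounded_const: "poly_bounded (\<lambda>n. c)"
  unfolding poly_bounded_def by (intro exI[of _ "[:c:]"]) simp

lemma poly_bounded_id: "poly_bounded (\<lambda>n. n)"
  unfolding poly_bounded_def by (intro exI[of _ "[:0, 1:]"]) simp

lemma poly_bounded_add:
  assumes "poly_bounded T" and "poly_bounded T'"
  shows "poly_bounded (\<lambda>n. T n + T' n)"
proof -
  obtain p p' where "\<forall>n. T n \<le> poly p n" "\<forall>n. T' n \<le> poly p' n"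
    using assms unfolding poly_bounded_def by blast
  then show ?thesis
    unfolding poly_bounded_def by (intro exI[of _ "p + p'"]) (simp add: add_mono)
qed

lemma poly_bounded_mult:
  assumes "poly_bounded T" and "poly_bounded T'"
  shows "poly_bounded (\<lambda>n. T n * T' n)"
proof -
  obtain p p' where "\<forall>n. T n \<le> poly p n" "\<forall>n. T' n \<le> poly p' n"
    using assms unfolding poly_bounded_def by blast
  then show ?thesis
    unfolding poly_bounded_def by (intro exI[of _ "p * p'"]) (simp add: mult_le_mono)
qed

lemmas poly_bounded_intros =
  poly_bounded_const poly_bounded_id poly_bounded_add poly_bounded_mult

definition symbols :: "letter cell set" where
  "symbols = insert Blank (range Inp \<union> (Aux \<circ> set_encode) ` Pow {..<num_marks})"

lemma finite_symbols: "finite symbols"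
  by (simp add: symbols_def)

lemma map_marks_in_symbols:
  assumes "y \<in> symbols" and "\<And>A. A \<subseteq> {..<num_marks} \<Longrightarrow> f A \<subseteq> {..<num_marks}"
  shows "map_marks f y \<in> symbols"
proof (cases y)
  case (Aux m)
  then obtain A where A: "A \<subseteq> {..<num_marks}" "m = set_encode A"
    using assms(1) by (auto simp: symbols_def)
  then have "set_decode m = A"
    using set_encode_inverse finite_subset[OF A(1)] by simp
  then show ?thesis
    using Aux A assms(2) by (auto simp: symbols_def)
qed (use assms in auto)

lemma writes_in_change:
  "(\<And>A. A \<subseteq> {..<num_marks} \<Longrightarrow> f A \<subseteq> {..<num_marks}) \<Longrightarrow> writes_in symbols (change f)"
  by (simp add: change_def rewrite_def map_marks_in_symbols)

lemma writes_in_basic [simp]: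
  "writes_in C succeed" "writes_in C fail" "writes_in C (test e P)" "writes_in C (move e d)"
  "writes_in C (seq p q) \<longleftrightarrow> writes_in C p \<and> writes_in C q"
  "writes_in C (cleanup p q) \<longleftrightarrow> writes_in C p \<and> writes_in C q"
  "writes_in C (rewind e)" "writes_in C (at_mark x)" "writes_in C (seek x)"
  "writes_in C at_end" "writes_in C skip_field" "writes_in C (goto_field b v)"
  "writes_in C (scan_field j a)" "writes_in C (field_test b v j a)" "writes_in C (has y x)"
  by (auto simp: succeed_def fail_def test_def move_def seq_def cleanup_def rewind_def at_mark_def
      seek_def at_end_def skip_field_def goto_field_def scan_field_def field_test_def has_def)

lemma writes_in_assign_set: "writes_in symbols (assign_set b x)"
  by (auto simp: assign_set_def num_marks_def intro!: writes_in_change split: if_splits)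

lemma writes_in_each: "is_var x \<Longrightarrow> writes_in symbols p \<Longrightarrow> writes_in symbols (each x p)"
  by (auto simp: each_def advance_def reset_def is_var_def intro!: writes_in_change)

datatype formula =
    Letter bool nat nat letter
  | Has nat nat
  | Neg formula
  | Conj formula formula
  | Exists nat formula

primrec holds :: "letter list \<Rightarrow> nat set \<Rightarrow> formula \<Rightarrow> (nat \<Rightarrow> nat) \<Rightarrow> bool" where
  "holds w S (Letter b v j a) \<sigma> \<longleftrightarrow> field_letter w (2 * \<sigma> v + of_bool b) (\<sigma> j) = Some a"
| "holds w S (Has y x) \<sigma> \<longleftrightarrow> (if y = 0 then \<sigma> x \<in> S else \<sigma> y = \<sigma> x)"
| "holds w S (Neg f) \<sigma> \<longleftrightarrow> \<not> holds w S f \<sigma>"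
| "holds w S (Conj f g) \<sigma> \<longleftrightarrow> holds w S f \<sigma> \<and> holds w S g \<sigma>"
| "holds w S (Exists x f) \<sigma> \<longleftrightarrow> (\<exists>i<length w. holds w S f (\<sigma>(x := i)))"

primrec bound_vars :: "formula \<Rightarrow> nat set" where
  "bound_vars (Letter b v j a) = {}"
| "bound_vars (Has y x) = {}"
| "bound_vars (Neg f) = bound_vars f"
| "bound_vars (Conj f g) = bound_vars f \<union> bound_vars g"
| "bound_vars (Exists x f) = insert x (bound_vars f)"

text \<open>Every variable has a single mark, and \<open>each\<close> expects it at position 0. A
  quantifier nested inside another one over the same variable would break this, hence the condition
  on \<open>bound_vars\<close>.\<close>

primrec admissible :: "formula \<Rightarrow> bool" where
  "admissible (Letter b v j a) \<longleftrightarrow> is_var v \<and> is_var j"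
| "admissible (Has y x) \<longleftrightarrow> y < num_marks \<and> is_var x"
| "admissible (Neg f) \<longleftrightarrow> admissible f"
| "admissible (Conj f g) \<longleftrightarrow> admissible f \<and> admissible g"
| "admissible (Exists x f) \<longleftrightarrow> is_var x \<and> x \<notin> bound_vars f \<and> admissible f"

primrec check :: "formula \<Rightarrow> prog" where
  "check (Letter b v j a) = field_test b v j a"
| "check (Has y x) = has y x"
| "check (Neg f) = Cond (check f) fail succeed"
| "check (Conj f g) = Cond (check f) (check g) fail"
| "check (Exists x f) = each x (check f)"

lemma writes_in_check: "admissible f \<Longrightarrow> writes_in symbols (check f)"
  by (induction f) (simp_all add: writes_in_each)

text \<open>The tape is returned unchanged, so that a check can be repeated inside a loop; the time
  bound depends neither on the assignment nor on the represented set.\<close>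

definition decides_within :: "prog \<Rightarrow> formula \<Rightarrow> (nat \<Rightarrow> nat) \<Rightarrow> bool" where
  "decides_within p f T \<longleftrightarrow> (\<forall>w \<sigma> S. w \<noteq> [] \<and> (\<forall>x. \<sigma> x < length w) \<and> (\<forall>x\<in>bound_vars f. \<sigma> x = 0) \<longrightarrow>
    runs_within p (state w \<sigma> S) (holds w S f \<sigma>) (state w \<sigma> S) (T (length w)))"

text \<open>Each quantifier adds one more loop over the word, so the degree of the bound grows with
  the nesting of quantifiers, which is constant for a fixed formula.\<close>

lemma runs_check: "admissible f \<Longrightarrow> \<exists>T. poly_bounded T \<and> decides_within (check f) f T"
proof (induction f)
  case (Letter b v j a)
  then show ?case
    unfolding decides_within_def check.simps holds.simps
    by (intro exI[of _ "\<lambda>n. n * (4 * n + 8) + (12 * n + 18)"] conjI poly_bounded_intros allI impI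
        runs_field_test) auto
next
  case (Has y x)
  have "y \<in> layout \<sigma> S (\<sigma> x) \<longleftrightarrow> holds w S (Has y x) \<sigma>"
    for w :: "letter list" and \<sigma> S
    using Has by (auto simp: layout_def)
  then have "decides_within (check (Has y x)) (Has y x) (\<lambda>n. 4 * n + 6)"
    unfolding decides_within_def using runs_has[of x _ _ y] Has by (auto simp del: holds.simps)
  then show ?case
    by (intro exI[of _ "\<lambda>n. 4 * n + 6"] conjI poly_bounded_intros)
next
  case (Neg f)
  then obtain T where T: "poly_bounded T" "decides_within (check f) f T"
    by auto
  have "runs_within (if b then fail else succeed) s (\<not> b) s 1" for b s
    using runs_succeed runs_fail by (cases b) auto
  with T(2) have "decides_within (check (Neg f)) (Neg f) (\<lambda>n. T n + 1)"
    unfolding decides_within_def check.simps holds.simps bound_vars.simps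
    by (blast intro: runs_within_Cond)
  with T(1) show ?case
    by (intro exI[of _ "\<lambda>n. T n + 1"] conjI poly_bounded_intros)
next
  case (Conj f g)
  then obtain T T' where T: "poly_bounded T" "decides_within (check f) f T"
    and T': "poly_bounded T'" "decides_within (check g) g T'"
    by auto
  have "decides_within (check (Conj f g)) (Conj f g) (\<lambda>n. T n + (T' n + 1))"
    unfolding decides_within_def
  proof (intro allI impI)
    fix w :: "letter list" and \<sigma> S
    assume prem: "w \<noteq> [] \<and> (\<forall>x. \<sigma> x < length w) \<and> (\<forall>x\<in>bound_vars (Conj f g). \<sigma> x = 0)"
    have "runs_within (check f) (state w \<sigma> S) (holds w S f \<sigma>) (state w \<sigma> S) (T (length w))"
      using T(2) prem unfolding decides_within_def by simp
    moreover have "runs_within (if holds w S f \<sigma> then check g else fail) (state w \<sigma> S)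
        (holds w S f \<sigma> \<and> holds w S g \<sigma>) (state w \<sigma> S) (T' (length w) + 1)"
    proof (cases "holds w S f \<sigma>")
      case True
      have "runs_within (check g) (state w \<sigma> S) (holds w S g \<sigma>) (state w \<sigma> S) (T' (length w))"
        using T'(2) prem unfolding decides_within_def by simp
      with True show ?thesis
        by (auto intro: runs_within_mono)
    next
      case False
      then show ?thesis
        by (auto intro: runs_within_mono[OF runs_fail])
    qed
    ultimately show "runs_within (check (Conj f g)) (state w \<sigma> S) (holds w S (Conj f g) \<sigma>)
        (state w \<sigma> S) (T (length w) + (T' (length w) + 1))"
      unfolding check.simps holds.simps by (rule runs_within_Cond)
  qed
  with T(1) T'(1) show ?case
    by (intro exI[of _ "\<lambda>n. T n + (T' n + 1)"] conjI poly_bounded_intros)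
next
  case (Exists x f)
  then obtain T where T: "poly_bounded T" "decides_within (check f) f T"
    by auto
  let ?T = "\<lambda>n. n * (T n + (4 * n + 13)) + (4 * n + 7)"
  have "decides_within (check (Exists x f)) (Exists x f) ?T"
    unfolding decides_within_def
  proof (intro allI impI)
    fix w :: "letter list" and \<sigma> S
    assume prem: "w \<noteq> [] \<and> (\<forall>x. \<sigma> x < length w) \<and> (\<forall>y\<in>bound_vars (Exists x f). \<sigma> y = 0)"
    \<comment> \<open>\<open>x\<close> is not bound in \<open>f\<close>, so the variables bound
      there are still 0 after the update.\<close>
    have "runs_within (check f) (state w (\<sigma>(x := i)) S) (holds w S f (\<sigma>(x := i)))
        (state w (\<sigma>(x := i)) S) (T (length w))" if "i < length w" for i
      using T(2)[unfolded decides_within_def, rule_format, of w "\<sigma>(x := i)" S] prem Exists.prems that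
      by auto
    then show "runs_within (check (Exists x f)) (state w \<sigma> S) (holds w S (Exists x f) \<sigma>)
        (state w \<sigma> S) (?T (length w))"
      using runs_each[of x \<sigma> w "check f" "\<lambda>_. S"] prem Exists.prems by auto
  qed
  with T(1) show ?case
    by (intro exI[of _ ?T] conjI poly_bounded_intros)
qed

section \<open>Least fixed points by repeated passes\<close>

definition least_closed :: "nat \<Rightarrow> (nat set \<Rightarrow> nat \<Rightarrow> bool) \<Rightarrow> nat set" where
  "least_closed n P = \<Inter> {U. \<forall>i<n. P U i \<longrightarrow> i \<in> U}"

text \<open>A pass updates the set in place, so an element found early is already used for the later
  positions of the same pass.\<close>

primrec pass :: "(nat set \<Rightarrow> nat \<Rightarrow> bool) \<Rightarrow> nat set \<Rightarrow> nat \<Rightarrow> nat set" where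
  "pass P S 0 = S"
| "pass P S (Suc i) = (if P (pass P S i) i then insert i (pass P S i) else pass P S i)"

text \<open>By monotonicity every intermediate set lies in each closed set, even with updates in
  place. Conversely, a set fixed by a pass is closed, and before stability each pass adds at least
  one of only \<open>n\<close> positions.\<close>

lemma passes_eq_least_closed:
  assumes mono: "\<And>S S' i. S \<subseteq> S' \<Longrightarrow> P S i \<Longrightarrow> P S' i"
  shows "((\<lambda>S. pass P S n) ^^ n) {} = least_closed n P"
proof -
  let ?F = "\<lambda>S. pass P S n"
  have incr: "S \<subseteq> pass P S i" for S i
    by (induction i) auto
  have range: "S \<subseteq> {..<n} \<Longrightarrow> i \<le> n \<Longrightarrow> pass P S i \<subseteq> {..<n}" for S i
    by (induction i) auto
  have sound: "pass P S i \<subseteq> U" if "S \<subseteq> U" "\<forall>i<n. P U i \<longrightarrow> i \<in> U" "i \<le> n" for S U i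
    using that(3) by (induction i) (use that mono in auto)
  \<comment> \<open>The set present when position \<open>i\<close> is handled contains
    \<open>S\<close>, so \<open>mono\<close> carries the condition over to it.\<close>
  have complete: "P S i \<Longrightarrow> i < m \<Longrightarrow> i \<in> pass P S m" for S i m
    by (induction m) (auto simp: less_Suc_eq dest: mono[OF incr])
  have sub: "(?F ^^ k) {} \<subseteq> {..<n}" for k
    by (induction k) (use range in auto)
  \<comment> \<open>Either the iteration is already stable, or each of the \<open>k\<close> passes
    has added an element.\<close>
  have progress: "?F ((?F ^^ k) {}) = (?F ^^ k) {} \<or> k \<le> card ((?F ^^ k) {})" for k
  proof (induction k)
    case (Suc k)
    show ?case
    proof (cases "?F ((?F ^^ k) {}) = (?F ^^ k) {}")
      case False
      then have "(?F ^^ k) {} \<subset> (?F ^^ Suc k) {}"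
        using incr by auto
      then have "card ((?F ^^ k) {}) < card ((?F ^^ Suc k) {})"
        using sub[of "Suc k"] finite_subset by (intro psubset_card_mono) blast+
      then show ?thesis
        using Suc False by auto
    qed simp
  qed simp
  have "?F ((?F ^^ n) {}) = (?F ^^ n) {}"
  proof (cases "n \<le> card ((?F ^^ n) {})")
    case True
    then have "(?F ^^ n) {} = {..<n}"
      using sub[of n] by (intro card_seteq) auto
    then show ?thesis
      using incr[of "{..<n}" n] range[of "{..<n}" n] by auto
  next
    case False
    then show ?thesis using progress[of n] by simp
  qed
  then have "\<forall>i<n. P ((?F ^^ n) {}) i \<longrightarrow> i \<in> (?F ^^ n) {}"
    using complete by metis
  moreover have "(?F ^^ k) {} \<subseteq> U" if "\<forall>i<n. P U i \<longrightarrow> i \<in> U" for U k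
    by (induction k) (use sound that in auto)
  ultimately show ?thesis
    unfolding least_closed_def by blast
qed

text \<open>The set left by an earlier start vertex is cleared before the passes. The variable
  \<open>k\<close> merely counts the passes, and every loop body fails so that no loop stops
  early.\<close>

definition closure :: "nat \<Rightarrow> nat \<Rightarrow> formula \<Rightarrow> prog" where
  "closure k x f = seq (each x (seq (assign_set False x) fail))
    (each k (each x (Cond (check f) (seq (assign_set True x) fail) fail)))"

lemma runs_each_False:
  assumes "is_var x" "\<sigma> x = 0" and "w \<noteq> []"
    and "\<And>i. i < length w \<Longrightarrow>
      runs_within p (state w (\<sigma>(x := i)) (S i)) False (state w (\<sigma>(x := i)) (S (Suc i))) T"
  shows "runs_within (each x p) (state w \<sigma> (S 0)) False (state w \<sigma> (S (length w)))
      (length w * (T + (4 * length w + 13)) + (4 * length w + 7))"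
  using runs_each[where S = S and B = "\<lambda>_. False", OF assms] by auto

definition loop_time :: "(nat \<Rightarrow> nat) \<Rightarrow> nat \<Rightarrow> nat" where
  "loop_time T n = n * (T n + (4 * n + 13)) + (4 * n + 7)"

definition assign_time :: "nat \<Rightarrow> nat" where
  "assign_time n = 4 * n + 6"

definition closure_time :: "(nat \<Rightarrow> nat) \<Rightarrow> nat \<Rightarrow> nat" where
  "closure_time T n =
    loop_time assign_time n + loop_time (loop_time (\<lambda>n. T n + assign_time n)) n"

lemma poly_bounded_closure_time: "poly_bounded T \<Longrightarrow> poly_bounded (closure_time T)"
  unfolding closure_time_def[abs_def] loop_time_def[abs_def] assign_time_def[abs_def]
  by (intro poly_bounded_intros)

lemma runs_closure:
  assumes var: "is_var x" "is_var k" "x \<noteq> k" "{x, k} \<inter> bound_vars f = {}"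
    and T: "decides_within (check f) f T"
    and w: "w \<noteq> []" and \<sigma>: "\<forall>y. \<sigma> y < length w" and zero: "\<forall>y\<in>{x, k} \<union> bound_vars f. \<sigma> y = 0"
    and S: "S \<subseteq> {..<length w}" and mono: "\<And>S S' i. S \<subseteq> S' \<Longrightarrow> P S i \<Longrightarrow> P S' i"
    and P: "\<And>S j i. holds w S f (\<sigma>(k := j, x := i)) \<longleftrightarrow> P S i"
  shows "runs_within (closure k x f) (state w \<sigma> S) False (state w \<sigma> (least_closed (length w) P))
    (closure_time T (length w))"
proof -
  define T2 where "T2 = (\<lambda>n. T n + assign_time n)"
  let ?N = "length w"
  have assign: "runs_within (seq (assign_set b x) fail) (state w (\<sigma>'(x := i)) S') False
      (state w (\<sigma>'(x := i)) (if b then insert i S' else S' - {i})) (assign_time ?N)" if "i < ?N" for b i S' \<sigma>'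
    using runs_seq[OF runs_assign_set[of x "\<sigma>'(x := i)" w b S'] runs_fail] var(1) that
    by (cases b) (simp_all add: assign_time_def add.commute)
  have "runs_within (each x (seq (assign_set False x) fail)) (state w \<sigma> (S - {..<0})) False
      (state w \<sigma> (S - {..<?N})) (loop_time assign_time ?N)"
    unfolding loop_time_def
  proof (rule runs_each_False[where S = "\<lambda>i. S - {..<i}"])
    fix i assume "i < ?N"
    moreover have "S - {..<i} - {i} = S - {..<Suc i}"
      by auto
    ultimately show "runs_within (seq (assign_set False x) fail) (state w (\<sigma>(x := i)) (S - {..<i}))
        False (state w (\<sigma>(x := i)) (S - {..<Suc i})) (assign_time ?N)"
      using assign[of i False \<sigma> "S - {..<i}"] by simp
  qed (use var zero w in auto)
  moreover have "S - {..<0} = S" "S - {..<?N} = {}"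
    using S by auto
  ultimately have clear: "runs_within (each x (seq (assign_set False x) fail)) (state w \<sigma> S) False
      (state w \<sigma> {}) (loop_time assign_time ?N)"
    by simp
  have pass: "runs_within (each x (Cond (check f) (seq (assign_set True x) fail) fail))
      (state w (\<sigma>(k := j)) S') False (state w (\<sigma>(k := j)) (pass P S' ?N)) (loop_time T2 ?N)"
    if j: "j < ?N" for j S'
  proof -
    have "runs_within (each x (Cond (check f) (seq (assign_set True x) fail) fail))
      (state w (\<sigma>(k := j)) (pass P S' 0)) False (state w (\<sigma>(k := j)) (pass P S' ?N)) (loop_time T2 ?N)"
      unfolding loop_time_def
    proof (rule runs_each_False[where S = "pass P S'"])
      fix i assume i: "i < ?N"
      let ?s = "state w (\<sigma>(k := j, x := i))"
      have "\<forall>y\<in>bound_vars f. (\<sigma>(k := j, x := i)) y = 0"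
        using zero var(4) by auto
      moreover have "\<forall>y. (\<sigma>(k := j, x := i)) y < ?N"
        using \<sigma> i j by simp
      ultimately have "runs_within (check f) (?s (pass P S' i)) (P (pass P S' i) i)
          (?s (pass P S' i)) (T ?N)"
        using T[unfolded decides_within_def, rule_format, of w "\<sigma>(k := j, x := i)" "pass P S' i"]
          w P by (simp del: fun_upd_apply)
      moreover have "runs_within (if P (pass P S' i) i then seq (assign_set True x) fail else fail)
          (?s (pass P S' i)) False (?s (pass P S' (Suc i))) (assign_time ?N)"
        using assign[OF i, of True "\<sigma>(k := j)" "pass P S' i"]
          runs_within_mono[OF runs_fail[of "?s (pass P S' i)"], of "assign_time ?N"]
        by (simp add: assign_time_def)
      ultimately show "runs_within (Cond (check f) (seq (assign_set True x) fail) fail)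
          (?s (pass P S' i)) False (?s (pass P S' (Suc i))) (T2 ?N)"
        unfolding T2_def by (rule runs_within_Cond)
    qed (use var zero w in auto)
    then show ?thesis by simp
  qed
  have "runs_within (each k (each x (Cond (check f) (seq (assign_set True x) fail) fail)))
      (state w \<sigma> (((\<lambda>S. pass P S ?N) ^^ 0) {})) False
      (state w \<sigma> (((\<lambda>S. pass P S ?N) ^^ ?N) {})) (loop_time (loop_time T2) ?N)"
    unfolding loop_time_def[of "loop_time T2"]
  proof (rule runs_each_False[where S = "\<lambda>i. ((\<lambda>S. pass P S ?N) ^^ i) {}"])
    fix i assume "i < ?N"
    from pass[OF this, of "((\<lambda>S. pass P S ?N) ^^ i) {}"]
    show "runs_within (each x (Cond (check f) (seq (assign_set True x) fail) fail))
        (state w (\<sigma>(k := i)) (((\<lambda>S. pass P S ?N) ^^ i) {})) False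
        (state w (\<sigma>(k := i)) (((\<lambda>S. pass P S ?N) ^^ Suc i) {})) (loop_time T2 ?N)"
      by simp
  qed (use var zero w in auto)
  then have "runs_within (each k (each x (Cond (check f) (seq (assign_set True x) fail) fail)))
      (state w \<sigma> {}) False (state w \<sigma> (least_closed ?N P)) (loop_time (loop_time T2) ?N)"
    using passes_eq_least_closed[of P ?N] mono by simp
  with clear show ?thesis
    unfolding closure_def closure_time_def T2_def by (rule runs_seq)
qed

section \<open>Initial contents of the second tape\<close>

definition prepare :: prog where
  "prepare = seq (rewrite True (\<lambda>_. Aux (set_encode {1..<num_marks})))
    (seq (seq (move False Move_Right) (move True Move_Right))
    (seq (Loop (test False (\<lambda>y. y = Blank)) (seq (rewrite True (\<lambda>_. Aux (set_encode {})))
      (seq (move False Move_Right) (move True Move_Right))))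
    (seq (rewind False) (rewind True))))"

text \<open>The cells aligned with the input receive \<open>Aux\<close> symbols, which differ from
  \<open>Blank\<close> even for the empty set of marks; so the second tape shows its ends as the
  input does. All variables start in cell 0, which is written before the loop and exists because the
  word is nonempty.\<close>

lemma runs_prepare:
  assumes "w \<noteq> []"
  shows "runs_within prepare (input_tape w, (\<lambda>_. Blank, 0)) True (state w (\<lambda>_. 0) {}) (8 * length w + 10)"
proof -
  let ?A = "layout (\<lambda>_. 0) {}" and ?N = "length w"
  define part :: "nat \<Rightarrow> int \<Rightarrow> int \<Rightarrow> tapes" where
    "part i k h = ((fst (input_tape w), h), (mark_tape i ?A, k))" for i h k
  have first: "?A 0 = {1..<num_marks}" and later: "?A (Suc i) = {}" for i
    by (auto simp: layout_def)
  have mark: "(mark_tape i ?A)(int i := Aux (set_encode (?A i))) = mark_tape (Suc i) ?A" for i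
    by (auto simp: mark_tape_def fun_eq_iff)
  have put: "runs_within (rewrite True (\<lambda>_. Aux (set_encode (?A i)))) (part i (int i) h) True
      (part (Suc i) (int i) h) 1" for i h
    by (rule runs_rewrite) (simp add: part_def mark)
  have right: "runs_within (seq (move False Move_Right) (move True Move_Right)) (part i k h) True
      (part i (k + 1) (h + 1)) (1 + 1)" for i k h
  proof (rule runs_seq)
    show "runs_within (move False Move_Right) (part i k h) True (part i k (h + 1)) 1"
      by (rule runs_move) (simp add: part_def read_tape_def)
    show "runs_within (move True Move_Right) (part i k (h + 1)) True (part i (k + 1) (h + 1)) 1"
      by (rule runs_move) (simp add: part_def read_tape_def)
  qed
  let ?s = "\<lambda>i. part (Suc i) (int (Suc i)) (int (Suc i))"
  have loop: "runs_within (Loop (test False (\<lambda>y. y = Blank)) (seq (rewrite True (\<lambda>_. Aux (set_encode {})))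
      (seq (move False Move_Right) (move True Move_Right)))) (?s 0) True (?s (?N - 1))
      ((?N - 1) * (1 + (1 + (1 + 1))) + 1)"
  proof (rule runs_within_Loop[where s = ?s])
    fix i assume "i < ?N - 1"
    then show "runs_within (test False (\<lambda>y. y = Blank)) (?s i) False (?s i) 1"
      by (intro runs_test) (simp add: part_def read_tape_def input_tape_def)
    show "runs_within (seq (rewrite True (\<lambda>_. Aux (set_encode {})))
        (seq (move False Move_Right) (move True Move_Right))) (?s i) True (?s (Suc i)) (1 + (1 + 1))"
      using runs_seq[OF put[of "Suc i" "int (Suc i)", unfolded later] right]
      by (simp add: algebra_simps)
  next
    have "runs_within (test False (\<lambda>y. y = Blank)) (?s (?N - 1)) True (?s (?N - 1)) 1"
      using assms by (intro runs_test) (simp add: part_def read_tape_def input_tape_def)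
    then show "runs_within (Loop (test False (\<lambda>y. y = Blank)) (seq (rewrite True (\<lambda>_. Aux (set_encode {})))
      (seq (move False Move_Right) (move True Move_Right)))) (?s (?N - 1)) True (?s (?N - 1)) 1"
      by (rule runs_within_Loop_found)
  qed
  have end_eq: "?s (?N - 1) = conf w ?A (int ?N) (int ?N)"
    using assms by (simp add: part_def conf_def)
  have start: "part 0 (int 0) (int 0) = (input_tape w, (\<lambda>_. Blank, 0))"
    by (simp add: part_def mark_tape_def input_tape_def fun_eq_iff)
  have rewind: "runs_within (seq (rewind False) (rewind True)) (?s (?N - 1)) True (state w (\<lambda>_. 0) {})
      ((2 * ?N + 3) + (2 * ?N + 3))"
    unfolding end_eq state_def
    using runs_seq[OF runs_rewind_input[of ?N w ?A "int ?N"] runs_rewind_marks[of ?N w ?A 0]] by simp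
  have right0: "runs_within (seq (move False Move_Right) (move True Move_Right)) (part (Suc 0) (int 0) (int 0))
      True (?s 0) (1 + 1)"
    using right[of "Suc 0" "int 0" "int 0"] by simp
  from runs_seq[OF put[of 0 "int 0", unfolded first start] runs_seq[OF right0 runs_seq[OF loop rewind]]]
  show ?thesis
    unfolding prepare_def by (rule runs_within_mono) simp
qed

lemma writes_in_prepare: "writes_in symbols prepare"
proof -
  have "Aux (set_encode A) \<in> symbols" if "A \<subseteq> {..<num_marks}" for A
    using that by (auto simp: symbols_def)
  from this[of "{}"] this[of "{1..<num_marks}"] show ?thesis
    by (simp add: prepare_def rewrite_def subset_eq)
qed

section \<open>The recognizer\<close>

definition row :: "letter list \<Rightarrow> nat \<Rightarrow> nat \<Rightarrow> letter \<Rightarrow> bool" where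
  "row w u j a \<longleftrightarrow> field_letter w (2 * u) j = Some a"

definition colour :: "letter list \<Rightarrow> nat \<Rightarrow> nat \<Rightarrow> letter \<Rightarrow> bool" where
  "colour w u j a \<longleftrightarrow> field_letter w (2 * u + 1) j = Some a"

text \<open>A graph has no loops, so the diagonal letter of the \<open>v\<close>-th row of an
  encoding is \<open>Zero\<close>. On arbitrary words \<open>well_formed\<close> ties this test to
  the existence of a row.\<close>

definition vertex :: "letter list \<Rightarrow> nat \<Rightarrow> bool" where
  "vertex w v \<longleftrightarrow> row w v v Zero"

text \<open>The separators take part in the comparison, so a colour is also told apart from its
  proper prefixes.\<close>

definition same_colour :: "letter list \<Rightarrow> nat \<Rightarrow> nat \<Rightarrow> bool" where
  "same_colour w u v \<longleftrightarrow> (\<forall>j<length w. \<forall>a. colour w u j a \<longleftrightarrow> colour w v j a)"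

text \<open>The clauses, in order, attach every row with a letter to a vertex, bound its length by
  the number of vertices from above and from below, force terminated fields and a colour starting
  with \<open>One\<close>, that is, a positive number without leading zeros, and make adjacency
  symmetric and properly coloured.\<close>

definition well_formed :: "letter list \<Rightarrow> bool" where
  "well_formed w \<longleftrightarrow> (\<forall>u<length w. \<forall>v<length w.
     (row w u v Zero \<or> row w u v One \<or> row w u v Sep \<longrightarrow> vertex w u) \<and>
     (row w u v Zero \<or> row w u v One \<longrightarrow> vertex w v) \<and>
     (vertex w u \<and> vertex w v \<longrightarrow> row w u v Zero \<or> row w u v One) \<and>
     (vertex w u \<longrightarrow> colour w u 0 One \<and> (\<exists>j<length w. colour w u j Sep) \<and>
        (\<exists>j<length w. row w u j Sep)) \<and>
     (row w u v One \<longrightarrow> row w v u One \<and> \<not> same_colour w u v))"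

definition unique_colour :: "letter list \<Rightarrow> nat \<Rightarrow> bool" where
  "unique_colour w v \<longleftrightarrow> vertex w v \<and> (\<forall>u<length w. vertex w u \<and> same_colour w u v \<longrightarrow> u = v)"

definition markable :: "letter list \<Rightarrow> nat \<Rightarrow> nat set \<Rightarrow> nat \<Rightarrow> bool" where
  "markable w v U p \<longleftrightarrow> vertex w p \<and> (p = v \<or>
     (\<forall>u<length w. vertex w u \<and> same_colour w u p \<longrightarrow> (\<exists>q<length w. q \<in> U \<and> row w u q One)))"

lemma markable_mono: "U \<subseteq> U' \<Longrightarrow> markable w v U p \<Longrightarrow> markable w v U' p"
  unfolding markable_def by (meson subsetD)

definition accepted :: "letter list \<Rightarrow> bool" where
  "accepted w \<longleftrightarrow> w \<noteq> [] \<and> well_formed w \<and> (\<exists>v<length w. unique_colour w v \<and>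
     (\<forall>u<length w. vertex w u \<longrightarrow> u \<in> least_closed (length w) (markable w v)))"

section \<open>Formulas for the acceptance condition\<close>

definition Disj :: "formula \<Rightarrow> formula \<Rightarrow> formula" where
  "Disj f g = Neg (Conj (Neg f) (Neg g))"

definition Imp :: "formula \<Rightarrow> formula \<Rightarrow> formula" where
  "Imp f g = Neg (Conj f (Neg g))"

definition Forall :: "nat \<Rightarrow> formula \<Rightarrow> formula" where
  "Forall x f = Neg (Exists x (Neg f))"

lemma holds_derived [simp]:
  "holds w S (Disj f g) \<sigma> \<longleftrightarrow> holds w S f \<sigma> \<or> holds w S g \<sigma>"
  "holds w S (Imp f g) \<sigma> \<longleftrightarrow> (holds w S f \<sigma> \<longrightarrow> holds w S g \<sigma>)"
  "holds w S (Forall x f) \<sigma> \<longleftrightarrow> (\<forall>i<length w. holds w S f (\<sigma>(x := i)))"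
  by (auto simp: Disj_def Imp_def Forall_def)

lemma bound_vars_derived [simp]:
  "bound_vars (Disj f g) = bound_vars f \<union> bound_vars g"
  "bound_vars (Imp f g) = bound_vars f \<union> bound_vars g"
  "bound_vars (Forall x f) = insert x (bound_vars f)"
  by (simp_all add: Disj_def Imp_def Forall_def)

lemma admissible_derived [simp]:
  "admissible (Disj f g) \<longleftrightarrow> admissible f \<and> admissible g"
  "admissible (Imp f g) \<longleftrightarrow> admissible f \<and> admissible g"
  "admissible (Forall x f) \<longleftrightarrow> is_var x \<and> x \<notin> bound_vars f \<and> admissible f"
  by (simp_all add: Disj_def Imp_def Forall_def)

abbreviation Row :: "nat \<Rightarrow> nat \<Rightarrow> letter \<Rightarrow> formula" where
  "Row \<equiv> Letter False"

abbreviation Colour :: "nat \<Rightarrow> nat \<Rightarrow> letter \<Rightarrow> formula" where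
  "Colour \<equiv> Letter True"

text \<open>Variable 1 is never quantified, so it keeps its initial value 0.\<close>

definition Same_Colour :: "nat \<Rightarrow> nat \<Rightarrow> formula" where
  "Same_Colour u v = Forall 7
     (let same = (\<lambda>a. Conj (Imp (Colour u 7 a) (Colour v 7 a)) (Imp (Colour v 7 a) (Colour u 7 a)))
      in Conj (same Zero) (Conj (same One) (same Sep)))"

definition Well_Formed :: formula where
  "Well_Formed = Forall 2 (Forall 5
     (Conj (Imp (Disj (Row 2 5 Zero) (Disj (Row 2 5 One) (Row 2 5 Sep))) (Row 2 2 Zero))
     (Conj (Imp (Disj (Row 2 5 Zero) (Row 2 5 One)) (Row 5 5 Zero))
     (Conj (Imp (Conj (Row 2 2 Zero) (Row 5 5 Zero)) (Disj (Row 2 5 Zero) (Row 2 5 One)))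
     (Conj (Imp (Row 2 2 Zero)
        (Conj (Colour 2 1 One) (Conj (Exists 7 (Colour 2 7 Sep)) (Exists 7 (Row 2 7 Sep)))))
     (Imp (Row 2 5 One) (Conj (Row 5 2 One) (Neg (Same_Colour 2 5)))))))))"

definition Unique_Colour :: formula where
  "Unique_Colour = Conj (Row 2 2 Zero)
     (Forall 5 (Imp (Conj (Row 5 5 Zero) (Same_Colour 5 2)) (Has 5 2)))"

text \<open>Variables 2, for the start vertex, and 4, for the candidate, stay free; 3 is left to the
  counter of passes, and 5, 6 and 7 are bound inside. With variable 1 as the constant 0 and mark 0
  for the set, this accounts for all eight marks.\<close>

definition Markable :: formula where
  "Markable = Conj (Row 4 4 Zero) (Disj (Has 4 2)
     (Forall 5 (Imp (Conj (Row 5 5 Zero) (Same_Colour 5 4)) (Exists 6 (Conj (Has 0 6) (Row 5 6 One))))))"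

definition All_Marked :: formula where
  "All_Marked = Forall 5 (Imp (Row 5 5 Zero) (Has 0 5))"

lemma all_letter: "(\<forall>a. P a) \<longleftrightarrow> P Zero \<and> P One \<and> P Sep"
  by (metis letter.exhaust)

lemma holds_Row: "holds w S (Row v j a) \<sigma> \<longleftrightarrow> row w (\<sigma> v) (\<sigma> j) a"
  by (simp add: row_def)

lemma holds_Colour: "holds w S (Colour v j a) \<sigma> \<longleftrightarrow> colour w (\<sigma> v) (\<sigma> j) a"
  by (simp add: colour_def)

lemma holds_Same_Colour:
  "u \<noteq> 7 \<Longrightarrow> v \<noteq> 7 \<Longrightarrow> holds w S (Same_Colour u v) \<sigma> \<longleftrightarrow> same_colour w (\<sigma> u) (\<sigma> v)"
  unfolding Same_Colour_def same_colour_def all_letter Let_def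
  by (simp add: holds_Row holds_Colour del: holds.simps(1)) blast

lemmas holds_simps = holds_Row holds_Colour holds_Same_Colour holds.simps(2-5)

lemma holds_Well_Formed: "\<sigma> 1 = 0 \<Longrightarrow> holds w S Well_Formed \<sigma> \<longleftrightarrow> well_formed w"
  unfolding Well_Formed_def well_formed_def vertex_def
  by (simp add: holds_simps del: holds.simps(1))

lemma holds_Unique_Colour: "holds w S Unique_Colour \<sigma> \<longleftrightarrow> unique_colour w (\<sigma> 2)"
  unfolding Unique_Colour_def unique_colour_def vertex_def
  by (simp add: holds_simps del: holds.simps(1))

lemma holds_Markable: "holds w S Markable \<sigma> \<longleftrightarrow> markable w (\<sigma> 2) S (\<sigma> 4)"
  unfolding Markable_def markable_def vertex_def
  by (simp add: holds_simps del: holds.simps(1))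

lemma holds_All_Marked: "holds w S All_Marked \<sigma> \<longleftrightarrow> (\<forall>u<length w. vertex w u \<longrightarrow> u \<in> S)"
  unfolding All_Marked_def vertex_def
  by (simp add: holds_simps del: holds.simps(1))

lemma bound_vars_formulas:
  "bound_vars Well_Formed = {2, 5, 7}" "bound_vars Unique_Colour = {5, 7}"
  "bound_vars Markable = {5, 6, 7}" "bound_vars All_Marked = {5}"
  by (auto simp: Well_Formed_def Unique_Colour_def Markable_def All_Marked_def Same_Colour_def Let_def)

lemma admissible_formulas:
  "admissible Well_Formed" "admissible Unique_Colour" "admissible Markable" "admissible All_Marked"
  by (simp_all add: Well_Formed_def Unique_Colour_def Markable_def All_Marked_def Same_Colour_def
      Let_def is_var_def num_marks_def)

section \<open>Searching for a start vertex\<close>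

definition search :: prog where
  "search = each 2 (Cond (check Unique_Colour) (seq (closure 3 4 Markable) (check All_Marked)) fail)"

lemma runs_search:
  "\<exists>T. poly_bounded T \<and> (\<forall>w. w \<noteq> [] \<longrightarrow> (\<exists>s. runs_within search (state w (\<lambda>_. 0) {})
    (\<exists>v<length w. unique_colour w v \<and>
      (\<forall>u<length w. vertex w u \<longrightarrow> u \<in> least_closed (length w) (markable w v)))
    s (T (length w))))"
proof -
  obtain T1 where T1: "poly_bounded T1" "decides_within (check Unique_Colour) Unique_Colour T1"
    using runs_check[OF admissible_formulas(2)] by blast
  obtain T3 where T3: "poly_bounded T3" "decides_within (check All_Marked) All_Marked T3"
    using runs_check[OF admissible_formulas(4)] by blast
  have var: "is_var 4" "is_var 3" "(4::nat) \<noteq> 3" "{4, 3} \<inter> bound_vars Markable = {}"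
    by (auto simp: is_var_def num_marks_def bound_vars_formulas)
  obtain T0 where T0: "poly_bounded T0" "decides_within (check Markable) Markable T0"
    using runs_check[OF admissible_formulas(3)] by blast
  define T2 where "T2 = closure_time T0"
  have T2: "poly_bounded T2"
    unfolding T2_def by (intro poly_bounded_closure_time T0)
  note closure = runs_closure[OF var T0(2), folded T2_def]
  define T where "T n = n * ((T1 n + (T2 n + T3 n + 1)) + (4 * n + 13)) + (4 * n + 7)" for n
  have "poly_bounded T"
    unfolding T_def[abs_def] by (intro poly_bounded_intros T1(1) T2 T3(1))
  moreover have "\<exists>s. runs_within search (state w (\<lambda>_. 0) {})
    (\<exists>v<length w. unique_colour w v \<and>
      (\<forall>u<length w. vertex w u \<longrightarrow> u \<in> least_closed (length w) (markable w v)))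
    s (T (length w))" if w: "w \<noteq> []" for w
  proof -
    let ?N = "length w" and ?L = "\<lambda>v. least_closed (length w) (markable w v)"
    let ?ok = "\<lambda>v. unique_colour w v \<and> (\<forall>u<length w. vertex w u \<longrightarrow> u \<in> ?L v)"
    \<comment> \<open>The set on the tape before round \<open>i\<close>: the closure computed in the
      latest round with a uniquely coloured start vertex, or the empty set if there was
      none.\<close>
    define S where "S = rec_nat {} (\<lambda>i U. if unique_colour w i then ?L i else U)"
    have S_Suc: "S (Suc i) = (if unique_colour w i then ?L i else S i)" for i
      by (simp add: S_def)
    have L: "?L v \<subseteq> {..<?N}" for v
      by (auto simp: least_closed_def)
    have S: "S i \<subseteq> {..<?N}" for i
      by (induction i) (auto simp: S_Suc L S_def)
    let ?\<sigma> = "\<lambda>i. (\<lambda>_. 0::nat)(2 := i)"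
    have body: "runs_within (Cond (check Unique_Colour) (seq (closure 3 4 Markable) (check All_Marked)) fail)
        (state w (?\<sigma> i) (S i)) (?ok i) (state w (?\<sigma> i) (S (Suc i))) (T1 ?N + (T2 ?N + T3 ?N + 1))"
      if i: "i < ?N" for i
    proof (rule runs_within_Cond)
      have env: "\<forall>x. ?\<sigma> i x < ?N" "\<forall>x\<in>bound_vars Unique_Colour. ?\<sigma> i x = 0"
        "\<forall>x\<in>bound_vars All_Marked. ?\<sigma> i x = 0" "\<forall>x\<in>{4, 3} \<union> bound_vars Markable. ?\<sigma> i x = 0"
        using i by (auto simp: bound_vars_formulas)
      show "runs_within (check Unique_Colour) (state w (?\<sigma> i) (S i)) (unique_colour w i)
          (state w (?\<sigma> i) (S i)) (T1 ?N)"
        using T1(2)[unfolded decides_within_def holds_Unique_Colour, rule_format, of w "?\<sigma> i" "S i"] w env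
        by simp
      show "runs_within (if unique_colour w i then seq (closure 3 4 Markable) (check All_Marked) else fail)
          (state w (?\<sigma> i) (S i)) (?ok i) (state w (?\<sigma> i) (S (Suc i))) (T2 ?N + T3 ?N + 1)"
      proof (cases "unique_colour w i")
        case True
        have "runs_within (closure 3 4 Markable) (state w (?\<sigma> i) (S i)) False (state w (?\<sigma> i) (?L i)) (T2 ?N)"
          using env w S by (intro closure) (auto simp: holds_Markable elim: markable_mono)
        moreover have "runs_within (check All_Marked) (state w (?\<sigma> i) (?L i))
            (\<forall>u<?N. vertex w u \<longrightarrow> u \<in> ?L i) (state w (?\<sigma> i) (?L i)) (T3 ?N)"
          using T3(2)[unfolded decides_within_def holds_All_Marked, rule_format, of w "?\<sigma> i" "?L i"] w env
          by simp
        ultimately have "runs_within (seq (closure 3 4 Markable) (check All_Marked)) (state w (?\<sigma> i) (S i))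
            (\<forall>u<?N. vertex w u \<longrightarrow> u \<in> ?L i) (state w (?\<sigma> i) (?L i)) (T2 ?N + T3 ?N)"
          by (rule runs_seq)
        from runs_within_mono[OF this, of "T2 ?N + T3 ?N + 1"] True show ?thesis
          by (simp add: S_Suc)
      next
        case False
        with runs_within_mono[OF runs_fail[of "state w (?\<sigma> i) (S i)"], of "T2 ?N + T3 ?N + 1"] show ?thesis
          by (simp add: S_Suc)
      qed
    qed
    have "is_var 2"
      by (simp add: is_var_def num_marks_def)
    from runs_each[where S = S and \<sigma> = "\<lambda>_. 0" and B = ?ok, OF this refl w body]
    show ?thesis
      unfolding search_def T_def S_def by (simp only: nat.rec) blast
  qed
  ultimately show ?thesis by blast
qed

text \<open>The empty word is rejected at once, since the loops assume that position 0 exists. It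
  encodes the graph without vertices, which is not connected.\<close>

definition recognizer :: prog where
  "recognizer = Cond (test False (\<lambda>y. y = Blank)) fail
    (seq prepare (Cond (check Well_Formed) search fail))"

lemma writes_in_recognizer: "writes_in symbols recognizer"
proof -
  have "is_var 2" "is_var 3" "is_var 4"
    by (simp_all add: is_var_def num_marks_def)
  then show ?thesis
    by (simp add: recognizer_def search_def closure_def writes_in_prepare writes_in_check
        admissible_formulas writes_in_each writes_in_assign_set)
qed

lemma accepted_in_class_P: "{w. accepted w} \<in> class_P"
proof -
  obtain T1 where T1: "poly_bounded T1" "decides_within (check Well_Formed) Well_Formed T1"
    using runs_check[OF admissible_formulas(1)] by blast
  obtain T2 where T2: "poly_bounded T2" and search: "\<And>w. w \<noteq> [] \<Longrightarrow>
    \<exists>s. runs_within search (state w (\<lambda>_. 0) {}) (\<exists>v<length w. unique_colour w v \<and>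
      (\<forall>u<length w. vertex w u \<longrightarrow> u \<in> least_closed (length w) (markable w v))) s (T2 (length w))"
    using runs_search by blast
  let ?T = "\<lambda>n. 1 + ((8 * n + 10) + (T1 n + (T2 n + 1)))"
  have "poly_bounded ?T"
    by (intro poly_bounded_intros T1 T2)
  then obtain p where p: "\<And>n. ?T n \<le> poly p n"
    unfolding poly_bounded_def by blast
  have "\<exists>s. runs_within recognizer (input_tape w, (\<lambda>_. Blank, 0)) (accepted w) s (?T (length w))" for w
  proof (cases "w = []")
    case True
    have "runs_within (test False (\<lambda>y. y = Blank)) (input_tape w, (\<lambda>_. Blank, 0)) True
        (input_tape w, (\<lambda>_. Blank, 0)) 1"
      using True by (intro runs_test) (simp add: input_tape_def read_tape_def)
    from runs_within_Cond[OF this, of fail] have "runs_within recognizer (input_tape w, (\<lambda>_. Blank, 0)) False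
        (input_tape w, (\<lambda>_. Blank, 0)) (1 + 1)"
      unfolding recognizer_def using runs_fail by simp
    then have "runs_within recognizer (input_tape w, (\<lambda>_. Blank, 0)) (accepted w)
        (input_tape w, (\<lambda>_. Blank, 0)) (?T (length w))"
      using True by (auto simp: accepted_def elim: runs_within_mono)
    then show ?thesis ..
  next
    case False
    have start: "runs_within (test False (\<lambda>y. y = Blank)) (input_tape w, (\<lambda>_. Blank, 0)) False
        (input_tape w, (\<lambda>_. Blank, 0)) 1"
      using False by (intro runs_test) (simp add: input_tape_def read_tape_def)
    have wf: "runs_within (check Well_Formed) (state w (\<lambda>_. 0) {}) (well_formed w) (state w (\<lambda>_. 0) {})
        (T1 (length w))"
      using T1(2)[unfolded decides_within_def, rule_format, of w "\<lambda>_. 0" "{}"] False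
      by (simp add: holds_Well_Formed)
    obtain s where "runs_within (if well_formed w then search else fail) (state w (\<lambda>_. 0) {})
        (accepted w) s (T2 (length w) + 1)"
    proof (cases "well_formed w")
      case True
      obtain s where "runs_within search (state w (\<lambda>_. 0) {}) (accepted w) s (T2 (length w))"
        using search[OF False] True False by (simp only: accepted_def simp_thms) blast
      from that[of s] runs_within_mono[OF this, of "T2 (length w) + 1"] True show thesis
        by simp
    next
      case wf: False
      from that[of "state w (\<lambda>_. 0) {}"] runs_within_mono[OF runs_fail, of "T2 (length w) + 1"] wf
      show thesis
        by (simp add: accepted_def)
    qed
    from runs_seq[OF runs_prepare[OF False] runs_within_Cond[OF wf this]]
    have "runs_within (if False then fail else seq prepare (Cond (check Well_Formed) search fail))
        (input_tape w, (\<lambda>_. Blank, 0)) (accepted w) s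
        ((8 * length w + 10) + (T1 (length w) + (T2 (length w) + 1)))"
      by simp
    from runs_within_Cond[OF start this] show ?thesis
      unfolding recognizer_def by blast
  qed
  then have "\<exists>t\<le>poly p (length w). \<exists>s. runs recognizer (input_tape w, (\<lambda>_. Blank, 0))
      (w \<in> {w. accepted w}) s t" for w
    unfolding runs_within_def mem_Collect_eq using p order_trans by meson
  moreover have "Blank \<in> symbols" "range Inp \<subseteq> symbols"
    by (auto simp: symbols_def)
  ultimately show ?thesis
    using class_P_I[OF finite_symbols _ _ writes_in_recognizer] by blast
qed

section \<open>Graphs of locality one\<close>

lemma equiv_path_rel: "equiv V (path_rel V E)"
proof (rule equivI)
  have "sym ({(a, b). {a, b} \<in> E}\<^sup>*)"
    by (intro sym_rtrancl symI) (simp add: insert_commute)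
  then show "sym (path_rel V E)"
    by (auto simp: path_rel_def sym_def)
  show "trans (path_rel V E)"
    by (auto simp: path_rel_def trans_def)
qed (auto simp: path_rel_def refl_on_def)

lemma connected_graph_iff_num_components:
  assumes "V \<noteq> {}"
  shows "connected_graph V E \<longleftrightarrow> num_components V E = 1"
proof
  assume conn: "connected_graph V E"
  have "X = Y" if XY: "X \<in> V // path_rel V E" "Y \<in> V // path_rel V E" for X Y
  proof -
    obtain x where x: "X = path_rel V E `` {x}" "x \<in> V"
      by (rule quotientE[OF XY(1)])
    obtain y where y: "Y = path_rel V E `` {y}" "y \<in> V"
      by (rule quotientE[OF XY(2)])
    have "(x, y) \<in> path_rel V E"
      using conn x y by (simp add: connected_graph_def)
    then show ?thesis
      using equiv_class_eq[OF equiv_path_rel] x y by metis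
  qed
  moreover obtain X where "X \<in> V // path_rel V E"
    using assms quotientI by fast
  ultimately have "V // path_rel V E = {X}"
    by blast
  then show "num_components V E = 1"
    by (simp add: num_components_def)
next
  assume "num_components V E = 1"
  then obtain X where X: "V // path_rel V E = {X}"
    by (auto simp: num_components_def card_1_singleton_iff)
  have "(u, v) \<in> path_rel V E" if "u \<in> V" "v \<in> V" for u v
  proof (rule eq_equiv_class[OF _ equiv_path_rel that(2)])
    have "path_rel V E `` {u} \<in> {X}" "path_rel V E `` {v} \<in> {X}"
      using quotientI[OF that(1), of "path_rel V E"] quotientI[OF that(2), of "path_rel V E"]
      unfolding X .
    then show "path_rel V E `` {u} = path_rel V E `` {v}"
      by simp
  qed
  then show "connected_graph V E"
    using assms by (simp add: connected_graph_def)
qed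

lemma num_components_pos:
  assumes "finite V" and "V \<noteq> {}"
  shows "1 \<le> num_components V E"
proof -
  have "V // path_rel V E \<noteq> {}"
    using assms quotientI by fast
  moreover have "finite (V // path_rel V E)"
    using assms by (simp add: quotient_def)
  ultimately show ?thesis
    by (simp add: num_components_def Suc_le_eq card_gt_0_iff)
qed

lemma marked_vertices_nonempty:
  assumes "xs \<in> marking_seqs V c" and "1 \<le> i" and "i \<le> length xs"
  shows "marked_vertices V c xs i \<noteq> {}"
proof -
  have "xs ! 0 \<in> set (take i xs)"
    using assms by (auto simp: in_set_conv_nth intro!: exI[of _ 0])
  moreover from this have "xs ! 0 \<in> c ` V"
    using assms(1) in_set_takeD by (fastforce simp: marking_seqs_def)
  ultimately show ?thesis
    by (auto simp: marked_vertices_def)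
qed

definition connected_marking :: "'v set \<Rightarrow> 'v set set \<Rightarrow> ('v \<Rightarrow> nat) \<Rightarrow> nat list \<Rightarrow> bool" where
  "connected_marking V E c xs \<longleftrightarrow> (\<forall>i\<in>{1..length xs}.
     connected_graph (marked_vertices V c xs i) (induced_edges E (marked_vertices V c xs i)))"

text \<open>Every stage is finite and nonempty, so each component count is at least 1. Hence the
  maximum is 1 iff all stages are connected, and the minimum over the finitely many marking
  sequences is 1 iff one of them attains it.\<close>

lemma loc_eq_1_iff:
  assumes V: "finite V" "V \<noteq> {}"
  shows "loc V E c = 1 \<longleftrightarrow> (\<exists>xs\<in>marking_seqs V c. connected_marking V E c xs)"
proof -
  let ?n = "\<lambda>xs i. num_components (marked_vertices V c xs i) (induced_edges E (marked_vertices V c xs i))"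
  have len: "1 \<le> length xs" if "xs \<in> marking_seqs V c" for xs
    using that V by (cases xs) (auto simp: marking_seqs_def)
  have pos: "1 \<le> ?n xs i" if "xs \<in> marking_seqs V c" "i \<in> {1..length xs}" for xs i
    using that V marked_vertices_nonempty[OF that(1), of i]
    by (intro num_components_pos) (auto simp: marked_vertices_def)
  have seq: "1 \<le> loc_seq V E c xs \<and> (loc_seq V E c xs = 1 \<longleftrightarrow> connected_marking V E c xs)"
    if xs: "xs \<in> marking_seqs V c" for xs
  proof -
    have "1 \<in> {1..length xs}"
      using len[OF xs] by simp
    then have ne: "?n xs ` {1..length xs} \<noteq> {}" and first: "?n xs 1 \<in> ?n xs ` {1..length xs}"
      by blast+
    have "1 \<le> loc_seq V E c xs"
      unfolding loc_seq_def using pos[OF xs, of 1] len[OF xs] first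
      by (intro order_trans[OF _ Max_ge[OF _ first]]) auto
    moreover have "loc_seq V E c xs = 1 \<longleftrightarrow> (\<forall>i\<in>{1..length xs}. ?n xs i = 1)"
    proof
      assume "loc_seq V E c xs = 1"
      then have "?n xs i \<le> 1" if "i \<in> {1..length xs}" for i
        using Max_ge[of "?n xs ` {1..length xs}" "?n xs i"] that by (simp add: loc_seq_def)
      then show "\<forall>i\<in>{1..length xs}. ?n xs i = 1"
        using pos[OF xs] by (meson le_antisym)
    next
      assume "\<forall>i\<in>{1..length xs}. ?n xs i = 1"
      then have "?n xs ` {1..length xs} = {1}"
        using ne by auto
      then show "loc_seq V E c xs = 1"
        by (simp add: loc_seq_def)
    qed
    moreover have "(\<forall>i\<in>{1..length xs}. ?n xs i = 1) \<longleftrightarrow> connected_marking V E c xs"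
      unfolding connected_marking_def using marked_vertices_nonempty[OF xs]
      by (intro ball_cong refl) (simp add: connected_graph_iff_num_components)
    ultimately show ?thesis by blast
  qed
  have fin: "finite (marking_seqs V c)"
    by (rule finite_subset[OF _ finite_subset_distinct[of "c ` V"]]) (use V in \<open>auto simp: marking_seqs_def\<close>)
  have ne: "marking_seqs V c \<noteq> {}"
    using finite_distinct_list[of "c ` V"] V by (auto simp: marking_seqs_def)
  have "loc V E c = 1 \<longleftrightarrow> 1 \<in> loc_seq V E c ` marking_seqs V c"
    unfolding loc_def using fin ne seq by (subst Min_eq_iff) auto
  then show ?thesis
    using seq by (metis (no_types, lifting) image_iff)
qed

lemma connected_graph_neighbour:
  assumes "connected_graph W (induced_edges E W)" and "u \<in> W" "v \<in> W" "u \<noteq> v"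
  obtains q where "q \<in> W" "{u, q} \<in> E"
proof -
  have "(u, v) \<in> {(a, b). {a, b} \<in> induced_edges E W}\<^sup>*"
    using assms by (auto simp: connected_graph_def path_rel_def)
  then obtain q where "{u, q} \<in> induced_edges E W"
    using assms(4) by (auto elim: converse_rtranclE)
  then show thesis
    using that by (auto simp: induced_edges_def)
qed

text \<open>Two vertices of \<open>W\<close> are joined by stepping into \<open>U\<close> where
  necessary, moving inside \<open>U\<close>, and stepping out again.\<close>

lemma connected_graph_extend:
  assumes U: "connected_graph U (induced_edges E U)" "U \<subseteq> W"
    and new: "\<And>u. u \<in> W - U \<Longrightarrow> \<exists>q\<in>U. {u, q} \<in> E"
  shows "connected_graph W (induced_edges E W)"
proof -
  let ?r = "\<lambda>W. {(a, b). {a, b} \<in> induced_edges E W}"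
  have sym: "sym ((?r W)\<^sup>*)"
    by (intro sym_rtrancl symI) (simp add: insert_commute)
  have mono: "(?r U)\<^sup>* \<subseteq> (?r W)\<^sup>*"
    using U(2) by (intro rtrancl_mono) (auto simp: induced_edges_def)
  have reach: "\<exists>u'\<in>U. (u, u') \<in> (?r W)\<^sup>*" if u: "u \<in> W" for u
  proof (cases "u \<in> U")
    case False
    then obtain q where "q \<in> U" "{u, q} \<in> E"
      using new u by blast
    then show ?thesis
      using u U(2) by (intro bexI[of _ q] r_into_rtrancl) (auto simp: induced_edges_def)
  qed blast
  have "(u, v) \<in> (?r W)\<^sup>*" if uv: "u \<in> W" "v \<in> W" for u v
  proof -
    obtain u' v' where u': "u' \<in> U" "(u, u') \<in> (?r W)\<^sup>*" and v': "v' \<in> U" "(v, v') \<in> (?r W)\<^sup>*"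
      using reach[OF uv(1)] reach[OF uv(2)] by auto
    have "(u', v') \<in> (?r W)\<^sup>*"
      using U(1) u' v' mono by (auto simp: connected_graph_def path_rel_def)
    with u' v' sym show ?thesis
      by (meson rtrancl_trans symD)
  qed
  then show ?thesis
    using U by (auto simp: connected_graph_def path_rel_def)
qed

section \<open>Connected markings and the greedy closure\<close>

definition marking_closed :: "'v set \<Rightarrow> 'v set set \<Rightarrow> ('v \<Rightarrow> nat) \<Rightarrow> 'v \<Rightarrow> 'v set \<Rightarrow> bool" where
  "marking_closed V E c v U \<longleftrightarrow> (\<forall>p\<in>V. p = v \<or>
     (\<forall>u\<in>V. c u = c p \<longrightarrow> (\<exists>q\<in>V. q \<in> U \<and> {u, q} \<in> E)) \<longrightarrow> p \<in> U)"

text \<open>Quantifying over all closed sets expresses that the least one is all of \<open>V\<close>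
  without constructing it, in a form that transfers easily between vertices and positions.\<close>

definition markable_from :: "'v set \<Rightarrow> 'v set set \<Rightarrow> ('v \<Rightarrow> nat) \<Rightarrow> 'v \<Rightarrow> bool" where
  "markable_from V E c v \<longleftrightarrow> v \<in> V \<and> (\<forall>u\<in>V. c u = c v \<longrightarrow> u = v) \<and>
     (\<forall>U. marking_closed V E c v U \<longrightarrow> V \<subseteq> U)"

lemma marked_vertices_Suc:
  "i < length xs \<Longrightarrow>
    marked_vertices V c xs (Suc i) = marked_vertices V c xs i \<union> {u\<in>V. c u = xs ! i}"
  by (auto simp: marked_vertices_def take_Suc_conv_app_nth)

text \<open>A closed set contains every stage of a connected marking, by induction on the stage:
  after the start vertex, the vertices of a new colour have neighbours in the new stage, and since
  the colouring is proper these lie in the previous stage.\<close>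

lemma connected_marking_imp_markable_from:
  assumes V: "V \<noteq> {}" and proper: "\<And>u v. u \<in> V \<Longrightarrow> v \<in> V \<Longrightarrow> {u, v} \<in> E \<Longrightarrow> c u \<noteq> c v"
    and xs: "xs \<in> marking_seqs V c" "connected_marking V E c xs"
  shows "\<exists>v. markable_from V E c v"
proof -
  let ?M = "marked_vertices V c xs"
  have dist: "distinct xs" and set: "set xs = c ` V"
    using xs by (auto simp: marking_seqs_def)
  have len: "0 < length xs"
    using set V by auto
  have sub: "?M i \<subseteq> V" for i
    by (auto simp: marked_vertices_def)
  have conn: "connected_graph (?M i) (induced_edges E (?M i))" if "i \<in> {1..length xs}" for i
    using xs(2) that by (auto simp: connected_marking_def)
  obtain v where v: "v \<in> V" "c v = xs ! 0"
    using len set by (metis imageE nth_mem)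
  have first: "?M 1 = {u\<in>V. c u = xs ! 0}"
    using marked_vertices_Suc[of 0 xs V c] len by (auto simp: marked_vertices_def)
  \<comment> \<open>A second vertex of the first colour would have a neighbour within the first
    stage, hence one of its own colour.\<close>
  have unique: "u = v" if "u \<in> V" "c u = c v" for u
  proof (rule ccontr)
    assume "u \<noteq> v"
    moreover have "u \<in> ?M 1" "v \<in> ?M 1" "1 \<in> {1..length xs}"
      using that v first len by (auto simp: Suc_le_eq)
    ultimately obtain q where "q \<in> ?M 1" "{u, q} \<in> E"
      using connected_graph_neighbour[OF conn] by metis
    then show False
      using proper[of u q] that v first by auto
  qed
  have "?M i \<subseteq> U" if U: "marking_closed V E c v U" and i: "i \<le> length xs" for U i
    using i
  proof (induction i)
    case 0
    then show ?case by (simp add: marked_vertices_def)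
  next
    case (Suc i)
    have "p \<in> U" if p: "p \<in> V" "c p = xs ! i" for p
    proof (cases "i = 0")
      case True
      then have "p = v"
        using unique p v by simp
      then show ?thesis
        using U p by (auto simp: marking_closed_def)
    next
      case False
      have "\<exists>q\<in>V. q \<in> U \<and> {u, q} \<in> E" if u: "u \<in> V" "c u = c p" for u
      proof -
        \<comment> \<open>The start vertex belongs to the stage and differs from \<open>u\<close>,
          so connectedness gives \<open>u\<close> a neighbour.\<close>
        have "xs ! i \<noteq> xs ! 0"
          using nth_eq_iff_index_eq[OF dist, of i 0] False len Suc.prems by simp
        then have "u \<noteq> v"
          using u p v by auto
        moreover have "v \<in> ?M (Suc i)"
          using v Suc.prems by (auto simp: marked_vertices_def in_set_conv_nth intro!: exI[of _ 0])
        moreover have "u \<in> ?M (Suc i)"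
          using u p Suc.prems marked_vertices_Suc[of i xs V c] by simp
        ultimately obtain q where q: "q \<in> ?M (Suc i)" "{u, q} \<in> E"
          using connected_graph_neighbour[OF conn[of "Suc i"], of u v] Suc.prems by auto
        then have "c q \<noteq> xs ! i"
          using proper[of u q] u p subsetD[OF sub q(1)] by auto
        then have "q \<in> ?M i"
          using q marked_vertices_Suc[of i xs V c] Suc.prems by auto
        then show ?thesis
          using q Suc sub by (meson Suc_leD subsetD)
      qed
      then show ?thesis
        using U p unfolding marking_closed_def by blast
    qed
    then show ?case
      using Suc marked_vertices_Suc[of i xs V c] by auto
  qed
  moreover have "?M (length xs) = V"
    using set by (auto simp: marked_vertices_def)
  ultimately have "markable_from V E c v"
    using unique v by (metis markable_from_def order_refl)
  then show ?thesis ..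
qed

lemma connected_marking_snoc:
  "connected_marking V E c (xs @ [x]) \<longleftrightarrow> connected_marking V E c xs \<and>
    connected_graph {u\<in>V. c u \<in> set (xs @ [x])} (induced_edges E {u\<in>V. c u \<in> set (xs @ [x])})"
proof -
  have "{1..length (xs @ [x])} = insert (Suc (length xs)) {1..length xs}"
    by auto
  moreover have "marked_vertices V c (xs @ [x]) i = marked_vertices V c xs i" if "i \<in> {1..length xs}" for i
    using that by (simp add: marked_vertices_def)
  moreover have "marked_vertices V c (xs @ [x]) (Suc (length xs)) = {u\<in>V. c u \<in> set (xs @ [x])}"
    by (simp add: marked_vertices_def)
  ultimately show ?thesis
    unfolding connected_marking_def by auto
qed

text \<open>A longest list of colours with connected stages that contains \<open>c v\<close>
  exhausts all colours: if its marked vertices were not closed, the colour of a vertex violating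
  closure could be appended.\<close>

lemma markable_from_imp_connected_marking:
  assumes V: "finite V" and v: "markable_from V E c v"
  shows "\<exists>xs\<in>marking_seqs V c. connected_marking V E c xs"
proof -
  let ?W = "\<lambda>xs. {u\<in>V. c u \<in> set xs}"
  let ?good = "\<lambda>xs. distinct xs \<and> set xs \<subseteq> c ` V \<and> c v \<in> set xs \<and>
    connected_marking V E c xs \<and> connected_graph (?W xs) (induced_edges E (?W xs))"
  have vV: "v \<in> V" and unique: "\<And>u. u \<in> V \<Longrightarrow> c u = c v \<Longrightarrow> u = v"
    using v by (auto simp: markable_from_def)
  have "?W [c v] = {v}"
    using vV unique by auto
  then have "connected_graph (?W [c v]) (induced_edges E (?W [c v]))"
    by (simp add: connected_graph_def path_rel_def)
  moreover from this have "connected_marking V E c [c v]"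
    using connected_marking_snoc[of V E c "[]" "c v"] by (simp add: connected_marking_def)
  ultimately have start: "?good [c v]"
    using vV by simp
  have bound: "length xs < Suc (card (c ` V))" if "?good xs" for xs
  proof -
    have "length xs = card (set xs)"
      using that by (simp add: distinct_card)
    also have "\<dots> \<le> card (c ` V)"
      using that V by (intro card_mono) auto
    finally show ?thesis by simp
  qed
  have "\<exists>xs. ?good xs \<and> (\<forall>ys. ?good ys \<longrightarrow> length ys \<le> length xs)"
    by (rule ex_has_greatest_nat[of ?good, OF start]) (use bound in blast)
  then obtain xs where xs: "?good xs" and max: "\<And>ys. ?good ys \<Longrightarrow> length ys \<le> length xs"
    by (elim exE conjE) blast
  have "marking_closed V E c v (?W xs)"
    unfolding marking_closed_def
  proof (intro ballI impI, rule ccontr)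
    fix p
    assume p: "p \<in> V" "p \<notin> ?W xs"
      and reach: "p = v \<or> (\<forall>u\<in>V. c u = c p \<longrightarrow> (\<exists>q\<in>V. q \<in> ?W xs \<and> {u, q} \<in> E))"
    have "p \<noteq> v"
      using p xs by auto
    have conn: "connected_graph (?W (xs @ [c p])) (induced_edges E (?W (xs @ [c p])))"
    proof (rule connected_graph_extend[of "?W xs"])
      show "connected_graph (?W xs) (induced_edges E (?W xs))"
        using xs by blast
      show "\<exists>q\<in>?W xs. {u, q} \<in> E" if "u \<in> ?W (xs @ [c p]) - ?W xs" for u
        using that reach \<open>p \<noteq> v\<close> by auto
    qed auto
    then have "connected_marking V E c (xs @ [c p])"
      using xs by (simp only: connected_marking_snoc simp_thms)
    moreover have "distinct (xs @ [c p])" "set (xs @ [c p]) \<subseteq> c ` V" "c v \<in> set (xs @ [c p])"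
      using xs p by auto
    ultimately have "?good (xs @ [c p])"
      using conn by (intro conjI)
    from max[OF this] show False by simp
  qed
  then have "V \<subseteq> ?W xs"
    using v unfolding markable_from_def by blast
  then have "xs \<in> marking_seqs V c"
    using xs by (auto simp: marking_seqs_def)
  with xs show ?thesis by blast
qed

text \<open>Supplies the connectedness that \<open>Loc_G_1\<close> demands: the last stage is the
  whole graph.\<close>

lemma connected_marking_imp_connected:
  assumes "simple_graph V E" "V \<noteq> {}" and xs: "xs \<in> marking_seqs V c" "connected_marking V E c xs"
  shows "connected_graph V E"
proof -
  have set: "set xs = c ` V"
    using xs by (simp add: marking_seqs_def)
  then have "length xs \<in> {1..length xs}"
    using assms(2) by (cases xs) auto
  moreover have "marked_vertices V c xs (length xs) = V"
    using set by (auto simp: marked_vertices_def)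
  moreover have "induced_edges E V = E"
    using assms(1) by (auto simp: induced_edges_def simple_graph_def)
  ultimately show ?thesis
    using xs(2) by (metis connected_marking_def)
qed

theorem connected_loc_1_iff:
  assumes "simple_graph V E" "V \<noteq> {}" and "valid_colouring V E c l"
  shows "connected_graph V E \<and> loc V E c = 1 \<longleftrightarrow> (\<exists>v. markable_from V E c v)"
proof -
  have fin: "finite V"
    using assms(1) by (simp add: simple_graph_def)
  have proper: "\<And>u v. u \<in> V \<Longrightarrow> v \<in> V \<Longrightarrow> {u, v} \<in> E \<Longrightarrow> c u \<noteq> c v"
    using assms(3) by (auto simp: valid_colouring_def)
  show ?thesis
    unfolding loc_eq_1_iff[OF fin assms(2)]
    using connected_marking_imp_markable_from[of V E c, OF assms(2) proper]
      markable_from_imp_connected_marking[OF fin] connected_marking_imp_connected[OF assms(1,2)]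
    by blast
qed

section \<open>Words that encode coloured graphs\<close>

lemma binary_eq_Nil_iff: "binary n = [] \<longleftrightarrow> n = 0"
  by (subst binary.simps) simp

text \<open>The side condition excludes the number 0, whose notation is the empty word rather than a
  digit.\<close>

lemma binary_snoc: "0 < k \<or> b \<Longrightarrow> binary (2 * k + of_bool b) = binary k @ [if b then One else Zero]"
  by (subst binary.simps) auto

lemma Sep_notin_binary: "Sep \<notin> set (binary n)"
  by (induction n rule: binary.induct) (subst binary.simps, auto)

lemma binary_inj: "binary m = binary n \<Longrightarrow> m = n"
proof (induction m arbitrary: n rule: less_induct)
  case (less m)
  show ?case
  proof (cases "m = 0 \<or> n = 0")
    case True
    then show ?thesis
      using less.prems binary_eq_Nil_iff by metis
  next
    case False
    then have "binary (m div 2) @ [if odd m then One else Zero] = binary (n div 2) @ [if odd n then One else Zero]"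
      using less.prems binary.simps by metis
    then have "binary (m div 2) = binary (n div 2)" "odd m \<longleftrightarrow> odd n"
      by (auto split: if_splits)
    moreover from this have "m div 2 = n div 2"
      using less.IH False by simp
    ultimately show ?thesis
      by (metis div_mult_mod_eq mod2_eq_if)
  qed
qed

lemma hd_binary: "0 < n \<Longrightarrow> hd (binary n) = One"
proof (induction n rule: less_induct)
  case (less n)
  have "binary n = binary (n div 2) @ [if odd n then One else Zero]"
    using less.prems by (subst binary.simps) simp
  moreover have "n div 2 = 0 \<Longrightarrow> odd n"
    using less.prems by presburger
  ultimately show ?case
    using less.IH[of "n div 2"] less.prems binary_eq_Nil_iff[of "n div 2"]
    by (cases "n div 2 = 0") auto
qed

text \<open>Induction from the right: the last letter is the parity, and what precedes it again
  starts with \<open>One\<close>, unless it is empty and the number is 1.\<close>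

lemma binary_surj:
  "bs \<noteq> [] \<Longrightarrow> hd bs = One \<Longrightarrow> Sep \<notin> set bs \<Longrightarrow> \<exists>k>0. binary k = bs"
proof (induction bs rule: rev_induct)
  case (snoc b bs)
  have b: "[if b = One then One else Zero] = [b]"
    using snoc.prems by (cases b) auto
  show ?case
  proof (cases "bs = []")
    case True
    then show ?thesis
      using snoc.prems binary_snoc[of 0 True] binary_eq_Nil_iff[of 0]
      by (intro exI[of _ 1]) simp
  next
    case False
    then obtain k where "0 < k" "binary k = bs"
      using snoc by auto
    then show ?thesis
      using binary_snoc[of k "b = One"] b by (intro exI[of _ "2 * k + of_bool (b = One)"]) simp
  qed
qed simp

section \<open>Splitting words into fields\<close>

definition join :: "letter list list \<Rightarrow> letter list" where
  "join fs = concat (map (\<lambda>f. f @ [Sep]) fs)"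

lemma field_letter_Sep_free:
  "Sep \<notin> set w \<Longrightarrow> field_letter w f j = (if f = 0 \<and> j < length w then Some (w ! j) else None)"
proof (induction w arbitrary: f j)
  case (Cons a w)
  then show ?case by (cases f; cases j) auto
qed simp

lemma field_letter_append:
  "Sep \<notin> set x \<Longrightarrow> field_letter (x @ Sep # w) f j =
    (case f of 0 \<Rightarrow> if j \<le> length x then Some ((x @ [Sep]) ! j) else None | Suc f \<Rightarrow> field_letter w f j)"
proof (induction x arbitrary: j)
  case Nil
  show ?case by (cases f; cases j) auto
next
  case (Cons a x)
  then show ?case by (cases f; cases j) auto
qed

lemma field_letter_join:
  "\<forall>x\<in>set fs. Sep \<notin> set x \<Longrightarrow> field_letter (join fs @ w) f j =
    (if f < length fs then if j \<le> length (fs ! f) then Some ((fs ! f @ [Sep]) ! j) else None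
     else field_letter w (f - length fs) j)"
proof (induction fs arbitrary: f)
  case (Cons x fs)
  then show ?case
    by (cases f) (auto simp: join_def field_letter_append)
qed (simp add: join_def)

text \<open>An arbitrary word may end in an unterminated rest \<open>x\<close>; acceptance will rule
  it out.\<close>

lemma fields_exist:
  "\<exists>fs x. w = join fs @ x \<and> (\<forall>y\<in>set fs. Sep \<notin> set y) \<and> Sep \<notin> set x"
proof (induction w)
  case Nil
  show ?case by (intro exI[of _ "[]"]) (simp add: join_def)
next
  case (Cons a w)
  then obtain fs x where w: "w = join fs @ x" "\<forall>y\<in>set fs. Sep \<notin> set y" "Sep \<notin> set x"
    by blast
  show ?case
  proof (cases "a = Sep")
    case True
    then show ?thesis
      using w by (intro exI[of _ "[] # fs"] exI[of _ x]) (simp add: join_def)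
  next
    case False
    show ?thesis
    proof (cases fs)
      case Nil
      then show ?thesis
        using w False by (intro exI[of _ "[]"] exI[of _ "a # x"]) (simp add: join_def)
    next
      case (Cons y ys)
      then show ?thesis
        using w False by (intro exI[of _ "(a # y) # ys"] exI[of _ x]) (simp add: join_def)
    qed
  qed
qed

lemma field_letter_bound: "field_letter w f j = Some a \<Longrightarrow> f < length w \<and> j < length w"
proof (induction w f j rule: field_letter.induct)
  case (4 a' w f j)
  then show ?case by (cases "a' = Sep") auto
qed (auto split: if_splits)

lemma row_bound: "row w u j a \<Longrightarrow> u < length w \<and> j < length w"
  using field_letter_bound[of w "2 * u" j a] by (auto simp: row_def)

lemma colour_bound: "colour w u j a \<Longrightarrow> u < length w \<and> j < length w"
  using field_letter_bound[of w "2 * u + 1" j a] by (auto simp: colour_def)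

definition pairs :: "('a \<Rightarrow> 'b) \<Rightarrow> ('a \<Rightarrow> 'b) \<Rightarrow> 'a list \<Rightarrow> 'b list" where
  "pairs f g vs = concat (map (\<lambda>v. [f v, g v]) vs)"

lemma length_pairs: "length (pairs f g vs) = 2 * length vs"
  by (induction vs) (auto simp: pairs_def)

lemma nth_pairs:
  "i < length vs \<Longrightarrow> pairs f g vs ! (2 * i) = f (vs ! i) \<and> pairs f g vs ! (2 * i + 1) = g (vs ! i)"
proof (induction vs arbitrary: i)
  case (Cons v vs)
  then show ?case by (cases i) (auto simp: pairs_def)
qed simp

definition adjacency_row :: "'v list \<Rightarrow> 'v set set \<Rightarrow> 'v \<Rightarrow> letter list" where
  "adjacency_row vs E v = map (\<lambda>u. if {v, u} \<in> E then One else Zero) vs"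

lemma encode_eq_join: "encode vs E c = join (pairs (adjacency_row vs E) (\<lambda>v. binary (c v)) vs)"
proof -
  have "concat (map (encode_vertex vs E c) us) = join (pairs (adjacency_row vs E) (\<lambda>v. binary (c v)) us)" for us
    by (induction us) (auto simp: join_def pairs_def encode_vertex_def adjacency_row_def)
  then show ?thesis by (simp add: encode_def)
qed

lemma field_letter_encode:
  assumes "i < length vs"
  shows "field_letter (encode vs E c) (2 * i) j =
      (if j < length vs then Some (if {vs ! i, vs ! j} \<in> E then One else Zero)
       else if j = length vs then Some Sep else None)"
    and "field_letter (encode vs E c) (2 * i + 1) j =
      (if j \<le> length (binary (c (vs ! i))) then Some ((binary (c (vs ! i)) @ [Sep]) ! j) else None)"
proof -
  let ?fs = "pairs (adjacency_row vs E) (\<lambda>v. binary (c v)) vs"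
  have "\<forall>x\<in>set ?fs. Sep \<notin> set x"
    using Sep_notin_binary by (auto simp: pairs_def adjacency_row_def)
  note letters = field_letter_join[OF this, of "[]"]
  note nth = nth_pairs[OF assms, of "adjacency_row vs E" "\<lambda>v. binary (c v)"]
  show "field_letter (encode vs E c) (2 * i) j =
      (if j < length vs then Some (if {vs ! i, vs ! j} \<in> E then One else Zero)
       else if j = length vs then Some Sep else None)"
    using letters[of "2 * i" j] nth assms
    by (auto simp: encode_eq_join length_pairs adjacency_row_def nth_append)
  show "field_letter (encode vs E c) (2 * i + 1) j =
      (if j \<le> length (binary (c (vs ! i))) then Some ((binary (c (vs ! i)) @ [Sep]) ! j) else None)"
    using letters[of "2 * i + 1" j] nth assms by (simp add: encode_eq_join length_pairs)
qed

lemma field_letter_encode_None: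
  assumes "2 * length vs \<le> f"
  shows "field_letter (encode vs E c) f j = None"
proof -
  have "\<forall>x\<in>set (pairs (adjacency_row vs E) (\<lambda>v. binary (c v)) vs). Sep \<notin> set x"
    using Sep_notin_binary by (auto simp: pairs_def adjacency_row_def)
  from field_letter_join[OF this, of "[]" f j] assms show ?thesis
    by (simp add: encode_eq_join length_pairs)
qed

lemma row_encode:
  "row (encode vs E c) u j a \<longleftrightarrow> u < length vs \<and>
    (j < length vs \<and> a = (if {vs ! u, vs ! j} \<in> E then One else Zero) \<or> j = length vs \<and> a = Sep)"
  unfolding row_def
  by (cases "u < length vs") (auto simp: field_letter_encode field_letter_encode_None)

lemma colour_encode:
  "colour (encode vs E c) u j a \<longleftrightarrow> u < length vs \<and>
    j \<le> length (binary (c (vs ! u))) \<and> a = (binary (c (vs ! u)) @ [Sep]) ! j"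
  unfolding colour_def
  by (cases "u < length vs") (auto simp: field_letter_encode(2)[simplified] field_letter_encode_None)

text \<open>No letter has an offset beyond the word, so the bounded comparison covers all offsets.
  Equal terminated fields have equal lengths and letters, and \<open>binary\<close> is
  injective.\<close>

lemma same_colour_encode:
  assumes "u < length vs" and "v < length vs"
  shows "same_colour (encode vs E c) u v \<longleftrightarrow> c (vs ! u) = c (vs ! v)"
proof
  let ?x = "binary (c (vs ! u))" and ?y = "binary (c (vs ! v))"
  assume same: "same_colour (encode vs E c) u v"
  have eq: "colour (encode vs E c) u j a \<longleftrightarrow> colour (encode vs E c) v j a" for j a
    using same colour_bound unfolding same_colour_def by blast
  have "j \<le> length ?x \<longleftrightarrow> j \<le> length ?y" for j
    using eq[of j] assms unfolding colour_encode by blast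
  then have len: "length ?x = length ?y"
    by (metis le_antisym order_refl)
  have "(?x @ [Sep]) ! j = (?y @ [Sep]) ! j" if "j \<le> length ?x" for j
    using eq[of j] assms that unfolding colour_encode by blast
  then have "?x @ [Sep] = ?y @ [Sep]"
    using len by (intro nth_equalityI) auto
  then show "c (vs ! u) = c (vs ! v)"
    using binary_inj by simp
next
  assume "c (vs ! u) = c (vs ! v)"
  then show "same_colour (encode vs E c) u v"
    using assms by (simp add: same_colour_def colour_encode)
qed

section \<open>Acceptance of encodings\<close>

locale encoded_graph =
  fixes vs :: "'v list" and E :: "'v set set" and c :: "'v \<Rightarrow> nat" and l :: nat
  assumes distinct: "distinct vs" and nonempty: "vs \<noteq> []" and graph: "simple_graph (set vs) E"
    and valid: "valid_colouring (set vs) E c l"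
begin

abbreviation word :: "letter list" where
  "word \<equiv> encode vs E c"

lemma no_loop: "{v} \<notin> E"
  using graph by (auto simp: simple_graph_def)

lemma vertex_word: "vertex word v \<longleftrightarrow> v < length vs"
  using no_loop by (auto simp: vertex_def row_encode)

text \<open>The separator after the row of the first vertex has offset \<open>length vs\<close>, and
  every offset of a letter is a position of the word. Hence quantifiers over positions reach all
  vertices.\<close>

lemma index_bound: "u \<le> length vs \<Longrightarrow> u < length word"
proof -
  have "row word 0 (length vs) Sep"
    using nonempty by (simp add: row_encode)
  then show "u \<le> length vs \<Longrightarrow> u < length word"
    using row_bound by fastforce
qed

lemma well_formed_word: "well_formed word"
proof -
  have "colour word u 0 One \<and> (\<exists>j<length word. colour word u j Sep) \<and> (\<exists>j<length word. row word u j Sep)"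
    if u: "u < length vs" for u
  proof -
    have "0 < c (vs ! u)"
      using valid u nth_mem by (fastforce simp: valid_colouring_def)
    then have "binary (c (vs ! u)) \<noteq> []" "binary (c (vs ! u)) ! 0 = One"
      using hd_binary binary_eq_Nil_iff by (auto simp: hd_conv_nth[symmetric])
    then have "colour word u 0 One"
      using u by (simp add: colour_encode nth_append)
    moreover have "colour word u (length (binary (c (vs ! u)))) Sep"
      using u by (simp add: colour_encode)
    moreover have "row word u (length vs) Sep"
      using u by (simp add: row_encode)
    ultimately show ?thesis
      using colour_bound row_bound by blast
  qed
  moreover have "row word v u One \<and> \<not> same_colour word u v" if "row word u v One" for u v
  proof -
    have uv: "u < length vs" "v < length vs" "{vs ! u, vs ! v} \<in> E"
      using that by (auto simp: row_encode split: if_splits)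
    then have "c (vs ! u) \<noteq> c (vs ! v)"
      using valid by (simp add: valid_colouring_def)
    then show ?thesis
      using uv by (simp add: row_encode same_colour_encode insert_commute)
  qed
  moreover have "vertex word u" if "row word u v a" for u v a
    using that by (auto simp: row_encode vertex_word)
  moreover have "vertex word v" if "row word u v Zero \<or> row word u v One" for u v
    using that by (auto simp: row_encode vertex_word)
  moreover have "row word u v Zero \<or> row word u v One" if "vertex word u \<and> vertex word v" for u v
    using that by (auto simp: row_encode vertex_word)
  ultimately show ?thesis
    unfolding well_formed_def vertex_word by blast
qed

lemma unique_colour_word:
  assumes "v < length vs"
  shows "unique_colour word v \<longleftrightarrow> (\<forall>u\<in>set vs. c u = c (vs ! v) \<longrightarrow> u = vs ! v)"
proof -
  have "unique_colour word v \<longleftrightarrow> (\<forall>u<length vs. c (vs ! u) = c (vs ! v) \<longrightarrow> u = v)"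
    using assms index_bound unfolding unique_colour_def vertex_word
    by (auto simp: same_colour_encode)
  also have "\<dots> \<longleftrightarrow> (\<forall>u<length vs. c (vs ! u) = c (vs ! v) \<longrightarrow> vs ! u = vs ! v)"
    using assms distinct by (auto simp: nth_eq_iff_index_eq)
  finally show ?thesis
    by (simp add: all_set_conv_all_nth)
qed

lemma markable_word:
  assumes "v < length vs" and "p < length vs"
  shows "markable word v U p \<longleftrightarrow> vs ! p = vs ! v \<or> (\<forall>u\<in>set vs. c u = c (vs ! p) \<longrightarrow>
    (\<exists>q<length vs. q \<in> U \<and> {u, vs ! q} \<in> E))"
proof -
  have bound: "u < length word" if "u < length vs" for u
    using that index_bound by simp
  have marked: "(\<exists>q<length word. q \<in> U \<and> row word u q One) \<longleftrightarrow>
      (\<exists>q<length vs. q \<in> U \<and> {vs ! u, vs ! q} \<in> E)" if "u < length vs" for u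
  proof -
    have "row word u q One \<longleftrightarrow> q < length vs \<and> {vs ! u, vs ! q} \<in> E" for q
      using that by (auto simp: row_encode)
    then show ?thesis
      using bound by blast
  qed
  have "(\<forall>u<length word. u < length vs \<and> same_colour word u p \<longrightarrow>
      (\<exists>q<length word. q \<in> U \<and> row word u q One)) \<longleftrightarrow>
    (\<forall>u<length vs. same_colour word u p \<longrightarrow> (\<exists>q<length word. q \<in> U \<and> row word u q One))"
    using bound by blast
  also have "\<dots> \<longleftrightarrow> (\<forall>u<length vs. c (vs ! u) = c (vs ! p) \<longrightarrow>
      (\<exists>q<length vs. q \<in> U \<and> {vs ! u, vs ! q} \<in> E))"
    using assms(2) by (simp add: marked same_colour_encode)
  finally have "markable word v U p \<longleftrightarrow> p = v \<or> (\<forall>u<length vs. c (vs ! u) = c (vs ! p) \<longrightarrow>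
      (\<exists>q<length vs. q \<in> U \<and> {vs ! u, vs ! q} \<in> E))"
    using assms(2) unfolding markable_def vertex_word by simp
  then show ?thesis
    using assms distinct by (simp add: all_set_conv_all_nth nth_eq_iff_index_eq)
qed

text \<open>Closed sets of vertices and closed sets of positions are translated into one another
  along \<open>vs\<close>, as preimages and images; hence one kind always covers all vertices iff
  the other does.\<close>

lemma all_marked_word:
  assumes v: "v < length vs"
  shows "(\<forall>u<length word. vertex word u \<longrightarrow> u \<in> least_closed (length word) (markable word v)) \<longleftrightarrow>
    (\<forall>U. marking_closed (set vs) E c (vs ! v) U \<longrightarrow> set vs \<subseteq> U)"
proof
  assume all: "\<forall>u<length word. vertex word u \<longrightarrow> u \<in> least_closed (length word) (markable word v)"
  show "\<forall>U. marking_closed (set vs) E c (vs ! v) U \<longrightarrow> set vs \<subseteq> U"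
  proof (intro allI impI)
    fix U
    assume U: "marking_closed (set vs) E c (vs ! v) U"
    let ?I = "{i. i < length vs \<and> vs ! i \<in> U}"
    have "p \<in> ?I" if p: "markable word v ?I p" for p
    proof -
      have "p < length vs"
        using p by (simp add: markable_def vertex_word)
      moreover from this have "vs ! p \<in> U"
        using p U nth_mem unfolding markable_word[OF v \<open>p < length vs\<close>] marking_closed_def
        by (metis (mono_tags, lifting) mem_Collect_eq)
      ultimately show ?thesis by simp
    qed
    then have "least_closed (length word) (markable word v) \<subseteq> ?I"
      unfolding least_closed_def by blast
    then have "vs ! u \<in> U" if "u < length vs" for u
      using all that index_bound[of u] vertex_word by auto
    then show "set vs \<subseteq> U"
      by (auto simp: in_set_conv_nth)
  qed
next
  assume all: "\<forall>U. marking_closed (set vs) E c (vs ! v) U \<longrightarrow> set vs \<subseteq> U"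
  show "\<forall>u<length word. vertex word u \<longrightarrow> u \<in> least_closed (length word) (markable word v)"
    unfolding least_closed_def
  proof (intro allI impI InterI)
    fix u I
    assume u: "vertex word u" and "I \<in> {U. \<forall>i<length word. markable word v U i \<longrightarrow> i \<in> U}"
    then have I: "i \<in> I" if "i < length vs" "markable word v I i" for i
      using that index_bound[of i] by simp
    \<comment> \<open>A closed set may contain positions beyond the vertices, where
      \<open>vs ! i\<close> is unspecified; these are cut off before taking the image.\<close>
    let ?U = "(!) vs ` (I \<inter> {..<length vs})"
    have "marking_closed (set vs) E c (vs ! v) ?U"
      unfolding marking_closed_def
    proof (intro ballI impI)
      fix p
      assume "p \<in> set vs" and reach: "p = vs ! v \<or> (\<forall>u\<in>set vs. c u = c p \<longrightarrow>
        (\<exists>q\<in>set vs. q \<in> ?U \<and> {u, q} \<in> E))"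
      then obtain i where i: "i < length vs" "p = vs ! i"
        by (auto simp: in_set_conv_nth)
      have "\<exists>q<length vs. q \<in> I \<and> {u, vs ! q} \<in> E" if "\<exists>q\<in>set vs. q \<in> ?U \<and> {u, q} \<in> E" for u
        using that by auto
      then have "markable word v I i"
        unfolding markable_word[OF v i(1)] using reach unfolding i(2) by metis
      then show "p \<in> ?U"
        using I i by blast
    qed
    then have "set vs \<subseteq> ?U"
      using all by blast
    moreover have "vs ! u \<in> set vs"
      using u by (simp add: vertex_word)
    ultimately have "vs ! u \<in> ?U"
      by (rule subsetD)
    then show "u \<in> I"
      using u distinct by (auto simp: vertex_word nth_eq_iff_index_eq)
  qed
qed

lemma accepted_word: "accepted word \<longleftrightarrow> connected_graph (set vs) E \<and> loc (set vs) E c = 1"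
proof -
  have "accepted word \<longleftrightarrow> (\<exists>v<length vs. markable_from (set vs) E c (vs ! v))"
  proof -
    let ?ok = "\<lambda>v. unique_colour word v \<and>
      (\<forall>u<length word. vertex word u \<longrightarrow> u \<in> least_closed (length word) (markable word v))"
    have "word \<noteq> []"
      using index_bound[of 0] by auto
    then have "accepted word \<longleftrightarrow> (\<exists>v<length word. ?ok v)"
      by (simp add: accepted_def well_formed_word)
    also have "\<dots> \<longleftrightarrow> (\<exists>v<length vs. ?ok v)"
      using index_bound[OF less_imp_le] unfolding unique_colour_def vertex_word by blast
    also have "\<dots> \<longleftrightarrow> (\<exists>v<length vs. markable_from (set vs) E c (vs ! v))"
      by (simp add: unique_colour_word all_marked_word markable_from_def cong: conj_cong)
    finally show ?thesis .
  qed
  also have "\<dots> \<longleftrightarrow> (\<exists>v. markable_from (set vs) E c v)"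
    by (metis in_set_conv_nth markable_from_def)
  also have "\<dots> \<longleftrightarrow> connected_graph (set vs) E \<and> loc (set vs) E c = 1"
    using connected_loc_1_iff[OF graph _ valid] nonempty by simp
  finally show ?thesis .
qed

end

text \<open>Well-formedness leaves only encodings: there are \<open>2 * n\<close> terminated fields
  and no rest, rows have length \<open>n\<close>, and colour fields are binary numbers. The graph is
  read off with the row indices as vertices.\<close>

lemma accepted_imp_encode:
  assumes acc: "accepted w"
  obtains vs :: "nat list" and E c l where "encoded_graph vs E c l" and "w = encode vs E c"
proof -
  have wf: "well_formed w"
    using acc by (simp add: accepted_def)
  have vertex_source: "vertex w u" if "row w u v a" for u v a
    using wf that row_bound[OF that] unfolding well_formed_def by (cases a) blast+
  have vertex_target: "vertex w v" if "row w u v a" "a \<noteq> Sep" for u v a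
    using wf that row_bound[OF that(1)] unfolding well_formed_def by (cases a) blast+
  have entry: "row w u v Zero \<or> row w u v One" if "vertex w u" "vertex w v" for u v
    using wf that row_bound[of w u u Zero] row_bound[of w v v Zero] unfolding well_formed_def vertex_def
    by blast
  have ends: "colour w u 0 One" "\<exists>j. colour w u j Sep" "\<exists>j. row w u j Sep" if "vertex w u" for u
    using wf that row_bound[of w u u Zero] unfolding well_formed_def vertex_def by blast+
  have edge: "row w v u One" "\<not> same_colour w u v" if "row w u v One" for u v
    using wf that row_bound[OF that] unfolding well_formed_def by blast+
  obtain fs x where w: "w = join fs @ x" and fs: "\<forall>y\<in>set fs. Sep \<notin> set y" and x: "Sep \<notin> set x"
    using fields_exist[of w] by blast
  have letters: "field_letter w f j =
    (if f < length fs then if j \<le> length (fs ! f) then Some ((fs ! f @ [Sep]) ! j) else None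
     else if f = length fs \<and> j < length x then Some (x ! j) else None)" for f j
    unfolding w field_letter_join[OF fs] field_letter_Sep_free[OF x] by auto
  have no_end: "field_letter w f j \<noteq> Some Sep" if "length fs \<le> f" for f j
    using that x by (auto simp: letters in_set_conv_nth)
  have row_end: "row w u (length (fs ! (2 * u))) Sep" if "2 * u < length fs" for u
    using that by (simp add: row_def letters)
  \<comment> \<open>In the odd case the last terminated field is a row; its vertex needs a
    terminated colour field, but no later field is terminated.\<close>
  have even: "even (length fs)"
  proof (rule ccontr)
    assume "odd (length fs)"
    then obtain u where u: "length fs = 2 * u + 1"
      by (auto elim: oddE)
    then have "\<exists>j. colour w u j Sep"
      using ends(2)[OF vertex_source[OF row_end[of u]]] by simp
    then show False
      using no_end[of "2 * u + 1"] u by (auto simp: colour_def)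
  qed
  then obtain n where n: "length fs = 2 * n"
    by (auto elim: evenE)
  \<comment> \<open>A nonempty rest would be the beginning of row \<open>n\<close>, so
    \<open>n\<close> would be a vertex and its row would have to be terminated.\<close>
  have "x = []"
  proof (rule ccontr)
    assume "x \<noteq> []"
    then have "row w n 0 (x ! 0)"
      by (simp add: row_def letters n)
    then have "\<exists>j. row w n j Sep"
      using ends(3) vertex_source by blast
    then show False
      using no_end[of "2 * n"] n by (auto simp: row_def)
  qed
  have vertex: "vertex w u \<longleftrightarrow> u < n" for u
  proof
    show "vertex w u \<Longrightarrow> u < n"
      by (auto simp: vertex_def row_def letters n \<open>x = []\<close> split: if_splits)
    show "u < n \<Longrightarrow> vertex w u"
      using vertex_source row_end[of u] n by simp
  qed
  have row: "row w u j a \<longleftrightarrow> j < length (fs ! (2 * u)) \<and> a = fs ! (2 * u) ! j \<or> j = length (fs ! (2 * u)) \<and> a = Sep"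
    if "u < n" for u j a
    using that n by (auto simp: row_def letters nth_append)
  have Sep_free: "fs ! f ! j \<noteq> Sep" if "f < length fs" "j < length (fs ! f)" for f j
    using that fs nth_mem by metis
  \<comment> \<open>A letter at offset \<open>n\<close> would make \<open>n\<close> a vertex; a
    shorter row has its separator where the entry for a vertex is required.\<close>
  have row_length: "length (fs ! (2 * u)) = n" if u: "u < n" for u
  proof (rule antisym)
    show "length (fs ! (2 * u)) \<le> n"
    proof (rule ccontr)
      assume "\<not> length (fs ! (2 * u)) \<le> n"
      then have "row w u n (fs ! (2 * u) ! n)" "fs ! (2 * u) ! n \<noteq> Sep"
        using row[OF u] Sep_free[of "2 * u" n] u n by auto
      then show False
        using vertex_target vertex by blast
    qed
    show "n \<le> length (fs ! (2 * u))"
    proof (rule ccontr)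
      assume less: "\<not> n \<le> length (fs ! (2 * u))"
      then have "row w u (length (fs ! (2 * u))) Zero \<or> row w u (length (fs ! (2 * u))) One"
        using entry vertex u by simp
      then show False
        using row[OF u] by simp
    qed
  qed
  have colour_field: "\<exists>k>0. binary k = fs ! (2 * u + 1)" if u: "u < n" for u
  proof (rule binary_surj)
    have "field_letter w (2 * u + 1) 0 = Some One"
      using ends(1) vertex u by (simp add: colour_def)
    then have "fs ! (2 * u + 1) \<noteq> [] \<and> fs ! (2 * u + 1) ! 0 = One"
      using u n by (cases "fs ! (2 * u + 1)") (auto simp: letters)
    then show "fs ! (2 * u + 1) \<noteq> []" "hd (fs ! (2 * u + 1)) = One"
      by (auto simp: hd_conv_nth)
    show "Sep \<notin> set (fs ! (2 * u + 1))"
      using fs u n by simp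
  qed
  \<comment> \<open>The value is unique by injectivity of \<open>binary\<close>; the choice replaces
    an explicit decoding.\<close>
  define c where "c u = (SOME k. 0 < k \<and> binary k = fs ! (2 * u + 1))" for u
  have c: "0 < c u" "binary (c u) = fs ! (2 * u + 1)" if "u < n" for u
    using someI_ex[OF colour_field[OF that]] by (simp_all add: c_def)
  \<comment> \<open>By \<open>edge\<close> the entries are symmetric, so passing to unordered pairs
    loses nothing.\<close>
  define E where "E = {{u, v} | u v. u < n \<and> v < n \<and> row w u v One}"
  have E: "{u, v} \<in> E \<longleftrightarrow> row w u v One" if "u < n" "v < n" for u v
    using that edge(1) by (auto simp: E_def doubleton_eq_iff)
  define l where "l = Max (c ` {..<n})"
  have "encode [0..<n] E c = join fs"
    unfolding encode_eq_join
  proof (rule arg_cong[where f = join], rule nth_equalityI)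
    show "length (pairs (adjacency_row [0..<n] E) (\<lambda>v. binary (c v)) [0..<n]) = length fs"
      by (simp add: length_pairs n)
    fix f
    assume "f < length (pairs (adjacency_row [0..<n] E) (\<lambda>v. binary (c v)) [0..<n])"
    then have f: "f < 2 * n"
      by (simp add: length_pairs)
    define u where "u = f div 2"
    have u: "u < n"
      using f by (simp add: u_def)
    have "adjacency_row [0..<n] E u = fs ! (2 * u)"
    proof (rule nth_equalityI)
      show "length (adjacency_row [0..<n] E u) = length (fs ! (2 * u))"
        by (simp add: adjacency_row_def row_length u)
      fix j
      assume "j < length (adjacency_row [0..<n] E u)"
      then have j: "j < n"
        by (simp add: adjacency_row_def)
      have "row w u j Zero \<or> row w u j One"
        using entry vertex u j by simp
      then show "adjacency_row [0..<n] E u ! j = fs ! (2 * u) ! j"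
        using E[OF u j] row[OF u] row_length[OF u] j by (auto simp: adjacency_row_def)
    qed
    moreover have "f = 2 * u \<or> f = 2 * u + 1"
      unfolding u_def by presburger
    ultimately show "pairs (adjacency_row [0..<n] E) (\<lambda>v. binary (c v)) [0..<n] ! f = fs ! f"
      using nth_pairs[of u "[0..<n]" "adjacency_row [0..<n] E" "\<lambda>v. binary (c v)"] u c(2)[OF u] by auto
  qed
  then have "w = encode [0..<n] E c"
    using w \<open>x = []\<close> by simp
  moreover have "encoded_graph [0..<n] E c l"
  proof
    obtain v where "vertex w v"
      using acc by (auto simp: accepted_def unique_colour_def)
    then show "[0..<n] \<noteq> []"
      using vertex by auto
    show "distinct [0..<n]"
      by simp
    \<comment> \<open>The diagonal letter of a vertex is \<open>Zero\<close>, so no entry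
      \<open>One\<close> yields a loop.\<close>
    have "u \<noteq> v" if "u < n" "row w u v One" for u v
      using that vertex[of u] by (auto simp: vertex_def row_def)
    then show "simple_graph (set [0..<n]) E"
      by (force simp: simple_graph_def E_def)
    have "c u \<in> {1..l}" if "u < n" for u
      using c(1)[OF that] that by (auto simp: l_def Suc_le_eq)
    moreover have "c u \<noteq> c v" if "u < n" "v < n" "{u, v} \<in> E" for u v
    proof
      assume "c u = c v"
      then have "fs ! (2 * u + 1) = fs ! (2 * v + 1)"
        using c(2) that by metis
      then have "same_colour w u v"
        using that n by (simp add: same_colour_def colour_def letters)
      then show False
        using E edge(2) that by blast
    qed
    ultimately show "valid_colouring (set [0..<n]) E c l"
      by (auto simp: valid_colouring_def)
  qed
  ultimately show thesis
    using that by blast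
qed

lemma Loc_G_1_eq_accepted: "Loc_G_1 = {w. accepted w}"
proof (intro set_eqI iffI)
  fix w
  assume "w \<in> Loc_G_1"
  then obtain vs :: "nat list" and E c l where "w = encode vs E c" and "distinct vs"
    "simple_graph (set vs) E" "valid_colouring (set vs) E c l"
    and conn: "connected_graph (set vs) E" and loc: "loc (set vs) E c = 1"
    unfolding Loc_G_1_def by blast
  moreover have "vs \<noteq> []"
    using conn by (auto simp: connected_graph_def)
  ultimately have "encoded_graph vs E c l"
    by unfold_locales
  from encoded_graph.accepted_word[OF this] show "w \<in> {w. accepted w}"
    using conn loc \<open>w = encode vs E c\<close> by simp
next
  fix w
  assume "w \<in> {w. accepted w}"
  then have acc: "accepted w" by simp
  obtain vs :: "nat list" and E c l where g: "encoded_graph vs E c l" and w: "w = encode vs E c"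
    using accepted_imp_encode[OF acc] .
  interpret encoded_graph vs E c l by (rule g)
  have "connected_graph (set vs) E \<and> loc (set vs) E c = 1"
    using acc accepted_word w by simp
  then show "w \<in> Loc_G_1"
    unfolding Loc_G_1_def using w distinct graph valid by blast
qed

theorem theorem7: "Loc_G_1 \<in> class_P"
  using accepted_in_class_P by (simp add: Loc_G_1_eq_accepted)

end
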